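(* Let $Z=m_{11}P_{11}+m_{12}P_{12}+m_{21}P_{21}$ be a set of fat points in $\mathbb{P}^1\times\mathbb{P}^1$ with $m_{11},m_{12},m_{21}\ge 0$ integers and $m_{12}\ge m_{21}$. If $m_{11}\le m_{21}$, then for all $(a,b)\in\mathbb{N}^2$ the bigraded Betti numbers of $I_Z$ are $$\beta_{0,(a,b)}(Z)=\begin{cases}\left(\min\{a,\ b-m_{11},\ m_{21}-m_{11}\}+1\right)_+ +\varphi_{m_{12},\,m_{12}-m_{11}}(b) & \text{if } a+b=m_{21}+m_{12},\\ 0 & \text{otherwise,}\end{cases}$$ $$\beta_{1,(a,b)}(Z)=\left(\beta_{0,(a,b-1)}(Z)+\beta_{0,(a-1,b)}(Z)-1\right)_+,$$ $$\beta_{2,(a,b)}(Z)=\left(\beta_{0,(a-1,b-1)}(Z)-1\right)_+.$$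
   Context: $k$ is an infinite field of characteristic $0$, and $R=k[x_0,x_1,x_2,x_3]$ is the coordinate ring of $\mathbb{P}^1\times\mathbb{P}^1$, bigraded by $\deg x_0=\deg x_1=(1,0)$, $\deg x_2=\deg x_3=(0,1)$. $\mathbb{N}=\{0,1,2,\dots\}$ and $(n)_+:=\max\{n,0\}$. Fat points: let $H_1,H_2$ be two non-proportional nonzero forms of degree $(1,0)$ and $V_1,V_2$ two non-proportional nonzero forms of degree $(0,1)$. $P_{ij}$ is the point with bihomogeneous ideal $I_{P_{ij}}=(H_i,V_j)$. For $Z=m_{11}P_{11}+m_{12}P_{12}+m_{21}P_{21}$ put $I_Z=I_{P_{11}}^{m_{11}}\cap I_{P_{12}}^{m_{12}}\cap I_{P_{21}}^{m_{21}}$ (with $I^0=R$). Betti numbers: $\beta_{u,(i,j)}(Z)$, $u=0,1,2$, are defined by the minimal bigraded free resolution of the ideal $$0\to\bigoplus R(-i,-j)^{\beta_{2,(i,j)}(Z)}\to\bigoplus R(-i,-j)^{\beta_{1,(i,j)}(Z)}\to\bigoplus R(-i,-j)^{\beta_{0,(i,j)}(Z)}\to I_Z\to 0,$$ so $\beta_{0,(i,j)}(Z)$ is the number of minimal generators of $I_Z$ of degree $(i,j)$. $\beta_{u,(i,j)}(Z)=0$ if $i<0$ or $j<0$. Numerical functions: for $t\in\mathbb{Z}$ define $\varphi_t:\mathbb{Z}\to\mathbb{Z}$ by: $\varphi_t=0$ for $t\le 0$; $\varphi_1(0)=1$ and $\varphi_1(n)=0$ for $n\ne0$; and for $t>1$,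 $\varphi_t(n)=\varphi_{t-1}(n)$ if $0\le n<t-1$, $\varphi_t(n)=\varphi_{t-1}(n)+1$ if $t-1\le n<2t-1$, and $\varphi_t(n)=0$ otherwise. For integers $t\ge d$ put $\varphi_{t,d}(n)=\varphi_t(n+d)-\varphi_d(n+d)$. *)

theory Defs
  imports
    "HOL-Library.Poly_Mapping"
    "HOL-Library.Numeral_Type"
    "HOL-Library.Product_Plus"
    "Jordan_Normal_Form.Matrix"
begin

text \<open>
  The ring R = k[x_0,x_1,x_2,x_3], with \<open>'k\<close> the field k: a polynomial is a finitely supported
  function on exponent vectors, and the variables are indexed by the four-element
  type \<open>4\<close> with elements 0, 1, 2, 3.
\<close>

type_synonym 'k bipoly = "(4 \<Rightarrow>\<^sub>0 nat) \<Rightarrow>\<^sub>0 'k"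

definition X :: "4 \<Rightarrow> 'k::field bipoly" where
  "X i = Poly_Mapping.single (Poly_Mapping.single i 1) 1"

definition scalar :: "'k::field \<Rightarrow> 'k bipoly" where
  "scalar c = Poly_Mapping.single 0 c"

definition bidegree :: "(4 \<Rightarrow>\<^sub>0 nat) \<Rightarrow> int \<times> int" where
  "bidegree m = (int (Poly_Mapping.lookup m 0 + Poly_Mapping.lookup m 1), int (Poly_Mapping.lookup m 2 + Poly_Mapping.lookup m 3))"

text \<open>The zero polynomial is bihomogeneous of every degree, and it is the only bihomogeneous
  element of a degree with a negative component.\<close>

definition bihomogeneous :: "int \<times> int \<Rightarrow> 'k::field bipoly \<Rightarrow> bool" where
  "bihomogeneous d p \<longleftrightarrow> (\<forall>m \<in> Poly_Mapping.keys p. bidegree m = d)"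

definition generated_ideal :: "'a::comm_ring_1 set \<Rightarrow> 'a set" where
  "generated_ideal S = module.span (*) S"

fun ideal_power :: "'a::comm_ring_1 set \<Rightarrow> nat \<Rightarrow> 'a set" where
  "ideal_power I 0 = UNIV"
| "ideal_power I (Suc n) = generated_ideal {x * y | x y. x \<in> I \<and> y \<in> ideal_power I n}"

text \<open>The ideal of m11 P11 + m12 P12 + m21 P21, where Pij has the ideal (Hi, Vj).\<close>

definition fat_points_ideal ::
    "'k::field bipoly \<Rightarrow> 'k bipoly \<Rightarrow> 'k bipoly \<Rightarrow> 'k bipoly \<Rightarrow> nat \<Rightarrow> nat \<Rightarrow> nat \<Rightarrow> 'k bipoly set" where
  "fat_points_ideal H1 H2 V1 V2 m11 m12 m21 =
     ideal_power (generated_ideal {H1, V1}) m11 \<inter>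
     ideal_power (generated_ideal {H1, V2}) m12 \<inter>
     ideal_power (generated_ideal {H2, V1}) m21"

text \<open>
  A minimal bigraded free resolution 0 --> F 2 --> F 1 --> F 0 --> I --> 0.  The list \<open>d u\<close>
  contains the bidegrees of the basis elements of F u, so that F u is the direct sum of the
  R(-i,-j) with (i,j) in \<open>d u\<close>, counted with multiplicity.  The map F u --> F (u - 1) is given by
  the matrix \<open>A u\<close> and the augmentation F 0 --> I by the vector \<open>g\<close>; the homogeneity conditions
  say that these maps preserve bidegrees.  F 3 = 0, so exactness at F 2 (the case u = 2) says
  that F 2 --> F 1 is injective.  The resolution is minimal if the image of F u --> F (u - 1)
  is contained in (x_0,x_1,x_2,x_3) F (u - 1).
\<close>

definition minimal_bigraded_free_resolution ::
    "'k::field bipoly set \<Rightarrow> (nat \<Rightarrow> (int \<times> int) list) \<Rightarrow> 'k bipoly vec \<Rightarrow> (nat \<Rightarrow> 'k bipoly mat) \<Rightarrow> bool"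
  where
  "minimal_bigraded_free_resolution I d g A \<longleftrightarrow>
     (\<forall>u > 2. d u = []) \<and>
     g \<in> carrier_vec (length (d 0)) \<and>
     (\<forall>u \<ge> 1. A u \<in> carrier_mat (length (d (u - 1))) (length (d u))) \<and>
     (\<forall>s < length (d 0). bihomogeneous (d 0 ! s) (g $ s)) \<and>
     (\<forall>u \<ge> 1. \<forall>s < length (d (u - 1)). \<forall>t < length (d u).
        bihomogeneous (d u ! t - d (u - 1) ! s) (A u $$ (s, t))) \<and>
     {g \<bullet> v | v. v \<in> carrier_vec (length (d 0))} = I \<and>
     {v \<in> carrier_vec (length (d 0)). g \<bullet> v = 0} =
       {A 1 *\<^sub>v w | w. w \<in> carrier_vec (length (d 1))} \<and>
     (\<forall>u \<ge> 1. {v \<in> carrier_vec (length (d u)). A u *\<^sub>v v = 0\<^sub>v (length (d (u - 1)))} =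
        {A (u + 1) *\<^sub>v w | w. w \<in> carrier_vec (length (d (u + 1)))}) \<and>
     (\<forall>u \<ge> 1. \<forall>s < length (d (u - 1)). \<forall>t < length (d u).
        A u $$ (s, t) \<in> generated_ideal (range X))"

text \<open>Degrees range over all pairs of integers, so that the Betti numbers at degrees such
  as (a - 1, b) with a = 0 need no separate convention: they vanish.\<close>

definition bigraded_betti :: "'k::field bipoly set \<Rightarrow> nat \<Rightarrow> int \<times> int \<Rightarrow> nat" where
  "bigraded_betti I u ij =
     (THE n. \<exists>d g A. minimal_bigraded_free_resolution I d g A \<and> count_list (d u) ij = n)"

function phi :: "int \<Rightarrow> int \<Rightarrow> int" where
  "phi t n =
     (if t \<le> 0 then 0
      else if t = 1 then (if n = 0 then 1 else 0)
      else if 0 \<le> n \<and> n < t - 1 then phi (t - 1) n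
      else if t - 1 \<le> n \<and> n < 2 * t - 1 then phi (t - 1) n + 1
      else 0)"
  by auto
termination by (relation "measure (\<lambda>(t, n). nat t)") auto

declare phi.simps [simp del]

definition phi2 :: "int \<Rightarrow> int \<Rightarrow> int \<Rightarrow> int" where
  "phi2 t d n = phi t (n + d) - phi d (n + d)"

definition pos_part :: "int \<Rightarrow> int" where
  "pos_part n = max n 0"

end

theory Submission
  imports Defs
begin

text \<open>
  After a linear change of coordinates the ideal is spanned by the monomials
  \<open>x\<^sub>0\<^sup>i x\<^sub>1\<^sup>j x\<^sub>2\<^sup>k x\<^sub>3\<^sup>l\<close> with \<open>i + k \<ge> m\<^sub>1\<^sub>1\<close>, \<open>i + l \<ge> m\<^sub>1\<^sub>2\<close> and
  \<open>j + k \<ge> m\<^sub>2\<^sub>1\<close>. Its minimal generators are indexed by the lattice points \<open>(a, c)\<close> of the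
  rectangle \<open>a \<le> m\<^sub>1\<^sub>2\<close>, \<open>c \<le> m\<^sub>2\<^sub>1\<close> with \<open>a + c \<ge> m\<^sub>1\<^sub>1\<close>, and the lattice points, unit edges and
  unit squares of this region support a cellular resolution, which is linear and therefore minimal.
  The bidegree of a cell determines a diagonal of the lattice, and each diagonal meets the region
  in consecutive points, so the three Betti numbers of a bidegree count the points on one diagonal,
  the edges between two adjacent diagonals, and the gaps between points of one diagonal.
\<close>

section \<open>Bihomogeneous polynomials and ideals\<close>

text \<open>The conditions for \<open>m12\<close> and \<open>m21\<close> involve disjoint pairs of
  variables. Alone they give the product of the powers \<open>(x0, x3)^m12\<close> and
  \<open>(x1, x2)^m21\<close>, whose resolution is the tensor product of two paths, that is, the
  full rectangle. The condition for \<open>m11\<close> couples x0 with x2 and cuts off the corner at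
  the origin, so the tensor product structure is lost. What survives is upward closure. Exactness is
  therefore shown for every upward closed set of lattice points in the rectangle: this class is
  stable under removing one minimal point, which allows an elementary induction without any topology
  of cell complexes. The bounds of \<open>m11\<close> by \<open>m12\<close> and \<open>m21\<close>
  keep the two far sides of the rectangle inside the region. Hence capping exponents at these sides
  loses no generator, and no diagonal becomes empty. Since \<open>bigraded_betti\<close> selects a
  number by \<open>THE\<close>, exhibiting one resolution is not enough: the counts have to agree
  for all minimal resolutions of the same ideal.\<close>

abbreviation const_coeff :: "'k::field bipoly \<Rightarrow> 'k" where
  "const_coeff p \<equiv> Poly_Mapping.lookup p 0"

lemma poly_mapping_sum_monomials:
  "(\<Sum>m\<in>Poly_Mapping.keys p. Poly_Mapping.single m (Poly_Mapping.lookup p m)) = p"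
  by (rule poly_mapping_eqI)
    (auto simp: lookup_sum lookup_single when_def in_keys_iff sum.delta)

text \<open>The monomial case remembers that \<open>m\<close> occurs in \<open>p\<close>. This lets
  an induction use a condition on the monomials of a fixed polynomial, such as membership in a
  monomial ideal.\<close>

lemma poly_mapping_monomial_induct [case_names monomial add]:
  fixes p :: "'a \<Rightarrow>\<^sub>0 'b::comm_monoid_add"
  assumes "\<And>m c. m \<in> Poly_Mapping.keys p \<Longrightarrow> P (Poly_Mapping.single m c)"
    and "\<And>f g. P f \<Longrightarrow> P g \<Longrightarrow> P (f + g)" and "P 0"
  shows "P p"
proof -
  have "P (\<Sum>m\<in>A. Poly_Mapping.single m (Poly_Mapping.lookup p m))"
    if "finite A" "A \<subseteq> Poly_Mapping.keys p" for A
    using that by (induction A) (auto intro: assms)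
  from this[of "Poly_Mapping.keys p"] show ?thesis
    by (simp add: poly_mapping_sum_monomials)
qed

lemma lookup_single_times:
  fixes p :: "(4 \<Rightarrow>\<^sub>0 nat) \<Rightarrow>\<^sub>0 'k::field"
  shows "Poly_Mapping.lookup (Poly_Mapping.single m c * p) (m + n) = c * Poly_Mapping.lookup p n"
proof (induction p rule: poly_mapping_monomial_induct)
  case (monomial m' c')
  then show ?case by (simp add: mult_single lookup_single when_def)
next
  case (add f g)
  then show ?case by (simp add: algebra_simps lookup_add)
qed simp

lemma keys_single_times:
  fixes p :: "(4 \<Rightarrow>\<^sub>0 nat) \<Rightarrow>\<^sub>0 'k::field"
  assumes "c \<noteq> 0"
  shows "Poly_Mapping.keys (Poly_Mapping.single m c * p) = (+) m ` Poly_Mapping.keys p"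
proof
  show "Poly_Mapping.keys (Poly_Mapping.single m c * p) \<subseteq> (+) m ` Poly_Mapping.keys p"
    using keys_mult[of "Poly_Mapping.single m c" p] assms by auto
  show "(+) m ` Poly_Mapping.keys p \<subseteq> Poly_Mapping.keys (Poly_Mapping.single m c * p)"
    using assms by (auto simp: in_keys_iff lookup_single_times)
qed

lemma exponents_add_eq_0_iff: "m + n = 0 \<longleftrightarrow> m = 0 \<and> n = (0 :: 4 \<Rightarrow>\<^sub>0 nat)"
  by (auto simp: poly_mapping_eq_iff fun_eq_iff lookup_add)

text \<open>Exponent vectors add up to 0 only if both are 0. Thus taking constant coefficients is
  the reduction of R modulo the irrelevant ideal, as a ring homomorphism to k.\<close>

lemma const_coeff_mult: "const_coeff (p * q) = const_coeff p * const_coeff q"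
proof (induction p rule: poly_mapping_monomial_induct)
  case (monomial m c)
  show ?case
  proof (induction q rule: poly_mapping_monomial_induct)
    case (monomial m' c')
    then show ?case by (auto simp: mult_single lookup_single when_def exponents_add_eq_0_iff)
  next
    case (add f g)
    then show ?case by (simp add: algebra_simps lookup_add)
  qed simp
next
  case (add f g)
  then show ?case by (simp add: algebra_simps lookup_add)
qed simp

lemma bidegree_add: "bidegree (m + n) = bidegree m + bidegree n"
  by (simp add: bidegree_def lookup_add)

lemma bidegree_0 [simp]: "bidegree 0 = 0"
  by (simp add: bidegree_def zero_prod_def)

lemma bihomogeneous_0 [simp]: "bihomogeneous d 0"
  by (simp add: bihomogeneous_def)

lemma bihomogeneous_1 [simp]: "bihomogeneous 0 1"
  by (simp add: bihomogeneous_def)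

lemma bihomogeneous_add: "bihomogeneous d p \<Longrightarrow> bihomogeneous d q \<Longrightarrow> bihomogeneous d (p + q)"
  using keys_add[of p q] by (auto simp: bihomogeneous_def)

lemma bihomogeneous_uminus: "bihomogeneous d (- p) \<longleftrightarrow> bihomogeneous d p"
  by (simp add: bihomogeneous_def in_keys_iff)

lemma bihomogeneous_mult:
  assumes "bihomogeneous d p" "bihomogeneous e q"
  shows "bihomogeneous (d + e) (p * q)"
  using assms keys_mult[of p q] by (fastforce simp: bihomogeneous_def bidegree_add)

lemma bihomogeneous_sum:
  "(\<And>i. i \<in> A \<Longrightarrow> bihomogeneous d (f i)) \<Longrightarrow> bihomogeneous d (sum f A)"
  by (induction A rule: infinite_finite_induct) (auto intro: bihomogeneous_add)

lemma const_coeff_bihomogeneous: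
  "bihomogeneous d p \<Longrightarrow> const_coeff p \<noteq> 0 \<Longrightarrow> d = 0"
  by (force simp: bihomogeneous_def in_keys_iff)

section \<open>Components of a given bidegree\<close>

definition bihomogeneous_part :: "int \<times> int \<Rightarrow> 'k::field bipoly \<Rightarrow> 'k bipoly" where
  "bihomogeneous_part d p =
     Poly_Mapping.mapp (\<lambda>m c. c when bidegree m = d) p"

lemma lookup_bihomogeneous_part:
  "Poly_Mapping.lookup (bihomogeneous_part d p) m =
     (if bidegree m = d then Poly_Mapping.lookup p m else 0)"
  by (simp add: bihomogeneous_part_def lookup_mapp when_def in_keys_iff)

lemma bihomogeneous_part_bihomogeneous: "bihomogeneous d (bihomogeneous_part d p)"
  by (auto simp: bihomogeneous_def in_keys_iff lookup_bihomogeneous_part split: if_splits)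

lemma bihomogeneous_part_add:
  "bihomogeneous_part d (p + q) = bihomogeneous_part d p + bihomogeneous_part d q"
  by (rule poly_mapping_eqI) (simp add: lookup_bihomogeneous_part lookup_add)

lemma bihomogeneous_part_0 [simp]: "bihomogeneous_part d 0 = 0"
  by (rule poly_mapping_eqI) (simp add: lookup_bihomogeneous_part)

lemma bihomogeneous_part_sum:
  "bihomogeneous_part d (sum f A) = (\<Sum>i\<in>A. bihomogeneous_part d (f i))"
  by (induction A rule: infinite_finite_induct) (auto simp: bihomogeneous_part_add)

lemma bihomogeneous_part_eq:
  assumes "bihomogeneous e p"
  shows "bihomogeneous_part d p = (if d = e then p else 0)"
  using assms
  by (intro poly_mapping_eqI) (auto simp: lookup_bihomogeneous_part bihomogeneous_def in_keys_iff)

lemma bihomogeneous_single: "bihomogeneous (bidegree m) (Poly_Mapping.single m c)"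
  by (auto simp: bihomogeneous_def)

text \<open>Multiplication by a form of degree \<open>e\<close> shifts degrees by \<open>e\<close>.
  This is what allows a linear system with homogeneous coefficients to be solved one degree at a
  time.\<close>

lemma bihomogeneous_part_mult:
  assumes "bihomogeneous e q"
  shows "bihomogeneous_part d (q * p) = q * bihomogeneous_part (d - e) p"
proof (induction p rule: poly_mapping_monomial_induct)
  case (monomial m c)
  have "bihomogeneous (e + bidegree m) (q * Poly_Mapping.single m c)"
    by (intro bihomogeneous_mult assms bihomogeneous_single)
  then show ?case
    by (auto simp: bihomogeneous_part_eq[OF bihomogeneous_single] bihomogeneous_part_eq
        algebra_simps)
next
  case (add f g)
  then show ?case by (simp add: bihomogeneous_part_add algebra_simps)
qed simp

section \<open>Ideals given by generators\<close>

lemma module_mult: "Modules.module ((*) :: 'a::comm_ring_1 \<Rightarrow> 'a \<Rightarrow> 'a)"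
  by unfold_locales (simp_all add: algebra_simps)

lemma generated_ideal_base: "x \<in> S \<Longrightarrow> x \<in> generated_ideal S"
  unfolding generated_ideal_def by (rule Modules.module.span_base[OF module_mult])

lemma generated_ideal_0: "0 \<in> generated_ideal S"
  unfolding generated_ideal_def by (rule Modules.module.span_zero[OF module_mult])

lemma generated_ideal_add: "x \<in> generated_ideal S \<Longrightarrow> y \<in> generated_ideal S \<Longrightarrow> x + y \<in> generated_ideal S"
  unfolding generated_ideal_def by (rule Modules.module.span_add[OF module_mult])

lemma generated_ideal_mult: "x \<in> generated_ideal S \<Longrightarrow> c * x \<in> generated_ideal S"
  unfolding generated_ideal_def by (rule Modules.module.span_scale[OF module_mult])

lemma generated_ideal_uminus: "x \<in> generated_ideal S \<Longrightarrow> - x \<in> generated_ideal S"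
  unfolding generated_ideal_def by (rule Modules.module.span_neg[OF module_mult])

lemma generated_ideal_induct [consumes 1, case_names zero base_add]:
  assumes "x \<in> generated_ideal S" "P 0"
    "\<And>c x y. x \<in> S \<Longrightarrow> P y \<Longrightarrow> P (c * x + y)"
  shows "P x"
  using Modules.module.span_induct_alt[OF module_mult, of x S P] assms
  unfolding generated_ideal_def by blast

lemma generated_ideal_sum:
  "(\<And>i. i \<in> A \<Longrightarrow> f i \<in> generated_ideal S) \<Longrightarrow> sum f A \<in> generated_ideal S"
  by (induction A rule: infinite_finite_induct) (auto intro: generated_ideal_0 generated_ideal_add)

lemma const_coeff_irrelevant_ideal:
  assumes "p \<in> generated_ideal (range (X :: 4 \<Rightarrow> 'k::field bipoly))"
  shows "const_coeff p = 0"
  using assms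
proof (induction rule: generated_ideal_induct)
  case (base_add c x y)
  have "Poly_Mapping.single i (1::nat) \<noteq> 0" for i :: 4
    by (metis lookup_single_eq lookup_zero one_neq_zero)
  then have "const_coeff (X i :: 'k bipoly) = 0" for i
    by (simp add: X_def lookup_single when_def)
  with base_add show ?case by (auto simp: lookup_add const_coeff_mult)
qed simp

section \<open>Uniqueness of minimal resolutions\<close>

definition homogeneous_mat :: "(int \<times> int) list \<Rightarrow> (int \<times> int) list \<Rightarrow> 'k::field bipoly mat \<Rightarrow> bool" where
  "homogeneous_mat e d M \<longleftrightarrow> M \<in> carrier_mat (length e) (length d) \<and>
     (\<forall>s < length e. \<forall>t < length d. bihomogeneous (d ! t - e ! s) (M $$ (s, t)))"

lemma homogeneous_mat_carrier: "homogeneous_mat e d M \<Longrightarrow> M \<in> carrier_mat (length e) (length d)"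
  by (simp add: homogeneous_mat_def)

lemma homogeneous_mat_one: "homogeneous_mat d d (1\<^sub>m (length d))"
  by (auto simp: homogeneous_mat_def)

lemma index_mult_mat_sum:
  "A \<in> carrier_mat n m \<Longrightarrow> B \<in> carrier_mat m l \<Longrightarrow> i < n \<Longrightarrow> j < l \<Longrightarrow>
    (A * B) $$ (i, j) = (\<Sum>s<m. A $$ (i, s) * B $$ (s, j))"
  by (auto simp: scalar_prod_def atLeast0LessThan intro!: sum.cong)

lemma homogeneous_mat_mult:
  assumes "homogeneous_mat e d M" "homogeneous_mat d f N"
  shows "homogeneous_mat e f (M * N)"
proof -
  note carr = assms[THEN homogeneous_mat_carrier]
  have "bihomogeneous (f ! t - e ! s) ((M * N) $$ (s, t))" if "s < length e" "t < length f" for s t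
    unfolding index_mult_mat_sum[OF carr that]
  proof (rule bihomogeneous_sum)
    fix j assume "j \<in> {..<length d}"
    then have "bihomogeneous ((d ! j - e ! s) + (f ! t - d ! j)) (M $$ (s, j) * N $$ (j, t))"
      using that assms by (intro bihomogeneous_mult) (auto simp: homogeneous_mat_def)
    then show "bihomogeneous (f ! t - e ! s) (M $$ (s, j) * N $$ (j, t))"
      by (simp add: algebra_simps)
  qed
  then show ?thesis
    using carr by (auto simp: homogeneous_mat_def)
qed

lemma lift_mat:
  assumes M: "M \<in> carrier_mat a b" and N: "N \<in> carrier_mat a c"
    and im: "\<And>t. t < c \<Longrightarrow> \<exists>w\<in>carrier_vec b. M *\<^sub>v w = col N t"
  obtains P where "P \<in> carrier_mat b c" "M * P = N"
proof -
  obtain w where w: "\<And>t. t < c \<Longrightarrow> w t \<in> carrier_vec b \<and> M *\<^sub>v w t = col N t"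
    using im by metis
  let ?P = "mat b c (\<lambda>(s, t). w t $ s)"
  have "M * ?P = N"
  proof (rule eq_matI)
    fix i j assume "i < dim_row N" "j < dim_col N"
    then have ij: "i < a" "j < c" using N by auto
    have "col ?P j = w j"
      using w[OF ij(2)] ij by (intro eq_vecI) auto
    then have "(M * ?P) $$ (i, j) = (M *\<^sub>v w j) $ i"
      using ij M by simp
    then show "(M * ?P) $$ (i, j) = N $$ (i, j)"
      using w[OF ij(2)] ij N by simp
  qed (use M N in auto)
  then show ?thesis using that[of ?P] by simp
qed

text \<open>Preimages chosen column by column need not be homogeneous. Replacing every entry by its
  component of the expected degree still solves the system, because \<open>M\<close> and
  \<open>N\<close> are homogeneous.\<close>

lemma lift_homogeneous_mat:
  assumes M: "homogeneous_mat e d M" and N: "homogeneous_mat e f N"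
    and im: "\<And>t. t < length f \<Longrightarrow> \<exists>w\<in>carrier_vec (length d). M *\<^sub>v w = col N t"
  obtains P where "homogeneous_mat d f P" "M * P = N"
proof -
  note carr = M[THEN homogeneous_mat_carrier] N[THEN homogeneous_mat_carrier]
  obtain P where P: "P \<in> carrier_mat (length d) (length f)" "M * P = N"
    using lift_mat[OF carr im] .
  let ?P = "mat (length d) (length f) (\<lambda>(s, t). bihomogeneous_part (f ! t - d ! s) (P $$ (s, t)))"
  have P': "?P \<in> carrier_mat (length d) (length f)" by simp
  have "homogeneous_mat d f ?P"
    by (auto simp: homogeneous_mat_def bihomogeneous_part_bihomogeneous)
  moreover have "M * ?P = N"
  proof (rule eq_matI)
    fix i j assume "i < dim_row N" "j < dim_col N"
    then have ij: "i < length e" "j < length f" using carr by auto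
    have "bihomogeneous (f ! j - e ! i) (N $$ (i, j))"
      using N ij by (simp add: homogeneous_mat_def)
    then have "N $$ (i, j) = bihomogeneous_part (f ! j - e ! i) (N $$ (i, j))"
      by (simp add: bihomogeneous_part_eq)
    also have "\<dots> = bihomogeneous_part (f ! j - e ! i) (\<Sum>s<length d. M $$ (i, s) * P $$ (s, j))"
      using index_mult_mat_sum[OF carr(1) P(1) ij] P(2) by simp
    also have "\<dots> =
        (\<Sum>s<length d. M $$ (i, s) * bihomogeneous_part (f ! j - d ! s) (P $$ (s, j)))"
      unfolding bihomogeneous_part_sum
    proof (rule sum.cong[OF refl])
      fix s assume "s \<in> {..<length d}"
      then have "bihomogeneous (d ! s - e ! i) (M $$ (i, s))"
        using M ij by (auto simp: homogeneous_mat_def)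
      from bihomogeneous_part_mult[OF this, of "f ! j - e ! i" "P $$ (s, j)"]
      show "bihomogeneous_part (f ! j - e ! i) (M $$ (i, s) * P $$ (s, j)) =
          M $$ (i, s) * bihomogeneous_part (f ! j - d ! s) (P $$ (s, j))"
        by (simp add: algebra_simps)
    qed
    also have "\<dots> = (M * ?P) $$ (i, j)"
      unfolding index_mult_mat_sum[OF carr(1) P' ij] using ij by (intro sum.cong) auto
    finally show "(M * ?P) $$ (i, j) = N $$ (i, j)" ..
  qed (use carr in auto)
  ultimately show ?thesis using that by blast
qed

text \<open>A resolution is treated as the exact complex obtained by appending the augmentation, with
  index shifted by one: \<open>augmented_map g A 0\<close> is the augmentation \<open>F 0 \<rightarrow> R\<close> and
  \<open>augmented_map g A (u + 1)\<close> the map \<open>F (u + 1) \<rightarrow> F u\<close>.\<close>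

definition augmented_map :: "'k::field bipoly vec \<Rightarrow> (nat \<Rightarrow> 'k bipoly mat) \<Rightarrow> nat \<Rightarrow> 'k bipoly mat" where
  "augmented_map g A u = (if u = 0 then mat_of_row g else A u)"

definition augmented_degrees :: "(nat \<Rightarrow> (int \<times> int) list) \<Rightarrow> nat \<Rightarrow> (int \<times> int) list" where
  "augmented_degrees d u = (if u = 0 then [0] else d (u - 1))"

lemma augmented_degrees_Suc [simp]: "augmented_degrees d (Suc u) = d u"
  by (simp add: augmented_degrees_def)

lemma mat_of_row_mult_vec_eq:
  assumes "g \<in> carrier_vec n" "v \<in> carrier_vec n" "y \<in> carrier_vec 1"
  shows "mat_of_row g *\<^sub>v v = y \<longleftrightarrow> g \<bullet> v = y $ 0"
  using assms by (auto simp: vec_eq_iff)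

locale minimal_resolution =
  fixes I :: "'k::field bipoly set" and d g A
  assumes res: "minimal_bigraded_free_resolution I d g A"
begin

abbreviation "\<delta> \<equiv> augmented_map g A"
abbreviation "D \<equiv> augmented_degrees d"

lemma homogeneous_map: "homogeneous_mat (D u) (d u) (\<delta> u)"
proof (cases u)
  case 0
  have "g \<in> carrier_vec (length (d 0))" "\<forall>s < length (d 0). bihomogeneous (d 0 ! s) (g $ s)"
    using res unfolding minimal_bigraded_free_resolution_def by - ((elim conjE, assumption)+)
  then show ?thesis
    using 0 by (auto simp: homogeneous_mat_def augmented_map_def augmented_degrees_def)
next
  case (Suc v)
  have "\<forall>u \<ge> 1. A u \<in> carrier_mat (length (d (u - 1))) (length (d u))"
    "\<forall>u \<ge> 1. \<forall>s < length (d (u - 1)). \<forall>t < length (d u).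
        bihomogeneous (d u ! t - d (u - 1) ! s) (A u $$ (s, t))"
    using res unfolding minimal_bigraded_free_resolution_def by - ((elim conjE, assumption)+)
  from this[rule_format, of "Suc v"] show ?thesis
    using Suc by (auto simp: homogeneous_mat_def augmented_map_def)
qed

lemma carrier: "\<delta> u \<in> carrier_mat (length (D u)) (length (d u))"
  by (rule homogeneous_mat_carrier[OF homogeneous_map])

lemma carrier_Suc: "\<delta> (Suc u) \<in> carrier_mat (length (d u)) (length (d (Suc u)))"
  using carrier[of "Suc u"] by simp

lemma exact:
  "{v \<in> carrier_vec (length (d u)). \<delta> u *\<^sub>v v = 0\<^sub>v (length (D u))} =
   {\<delta> (Suc u) *\<^sub>v w | w. w \<in> carrier_vec (length (d (Suc u)))}"
proof (cases u)
  case 0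
  have g: "g \<in> carrier_vec (length (d 0))"
    and ex: "{v \<in> carrier_vec (length (d 0)). g \<bullet> v = 0} =
       {A 1 *\<^sub>v w | w. w \<in> carrier_vec (length (d 1))}"
    using res unfolding minimal_bigraded_free_resolution_def by - ((elim conjE, assumption)+)
  have "{v \<in> carrier_vec (length (d 0)). mat_of_row g *\<^sub>v v = 0\<^sub>v 1} =
      {v \<in> carrier_vec (length (d 0)). g \<bullet> v = 0}"
    using mat_of_row_mult_vec_eq[OF g] by auto
  with 0 ex show ?thesis by (simp add: augmented_map_def augmented_degrees_def)
next
  case (Suc v)
  have "\<forall>u \<ge> 1. {v \<in> carrier_vec (length (d u)). A u *\<^sub>v v = 0\<^sub>v (length (d (u - 1)))} =
        {A (u + 1) *\<^sub>v w | w. w \<in> carrier_vec (length (d (u + 1)))}"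
    using res unfolding minimal_bigraded_free_resolution_def by - (elim conjE, assumption)
  from this[rule_format, of "Suc v"] show ?thesis
    using Suc by (simp add: augmented_map_def)
qed

lemma image_augmentation:
  assumes "y \<in> carrier_vec 1"
  shows "(\<exists>v\<in>carrier_vec (length (d 0)). \<delta> 0 *\<^sub>v v = y) \<longleftrightarrow> y $ 0 \<in> I"
proof -
  have g: "g \<in> carrier_vec (length (d 0))"
    and im: "{g \<bullet> v | v. v \<in> carrier_vec (length (d 0))} = I"
    using res unfolding minimal_bigraded_free_resolution_def by - ((elim conjE, assumption)+)
  then show ?thesis
    using mat_of_row_mult_vec_eq[OF g _ assms] by (auto simp: augmented_map_def)
qed

lemma minimal:
  assumes "s < length (d u)" "t < length (d (Suc u))"
  shows "const_coeff (\<delta> (Suc u) $$ (s, t)) = 0"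
proof -
  have "\<forall>u \<ge> 1. \<forall>s < length (d (u - 1)). \<forall>t < length (d u).
        A u $$ (s, t) \<in> generated_ideal (range X)"
    using res unfolding minimal_bigraded_free_resolution_def by - (elim conjE, assumption)
  from this[rule_format, of "Suc u"] show ?thesis
    using assms by (auto simp: augmented_map_def intro!: const_coeff_irrelevant_ideal)
qed

lemma map_map: "\<delta> u * \<delta> (Suc u) = 0\<^sub>m (length (D u)) (length (d (Suc u)))" (is "?L = ?R")
proof (rule eq_matI)
  fix i j assume ij: "i < dim_row ?R" "j < dim_col ?R"
  have "\<delta> (Suc u) *\<^sub>v unit_vec (length (d (Suc u))) j \<in>
      {\<delta> (Suc u) *\<^sub>v w | w. w \<in> carrier_vec (length (d (Suc u)))}" by auto
  then have "\<delta> u *\<^sub>v (\<delta> (Suc u) *\<^sub>v unit_vec (length (d (Suc u))) j) = 0\<^sub>v (length (D u))"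
    unfolding exact[symmetric] by simp
  moreover have "\<delta> (Suc u) *\<^sub>v unit_vec (length (d (Suc u))) j = col (\<delta> (Suc u)) j"
    using ij carrier_Suc[of u] by (intro eq_vecI) auto
  ultimately have "(\<delta> u *\<^sub>v col (\<delta> (Suc u)) j) $ i = 0"
    using ij by simp
  then show "?L $$ (i, j) = ?R $$ (i, j)"
    using ij carrier[of u] carrier_Suc[of u] by simp
qed (use carrier[of u] carrier_Suc[of u] in auto)

lemma exact_image:
  assumes N: "N \<in> carrier_mat (length (d u)) c"
    and zero: "\<delta> u * N = 0\<^sub>m (length (D u)) c" and "t < c"
  shows "\<exists>w\<in>carrier_vec (length (d (Suc u))). \<delta> (Suc u) *\<^sub>v w = col N t"
proof -
  have "\<delta> u *\<^sub>v col N t = col (\<delta> u * N) t"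
    using N carrier[of u] \<open>t < c\<close> by (simp add: col_mult2)
  then have "\<delta> u *\<^sub>v col N t = 0\<^sub>v (length (D u))"
    using zero \<open>t < c\<close> by simp
  then have "col N t \<in> {v \<in> carrier_vec (length (d u)). \<delta> u *\<^sub>v v = 0\<^sub>v (length (D u))}"
    using N \<open>t < c\<close> by auto
  then show ?thesis unfolding exact by force
qed

end

section \<open>Comparison of two minimal resolutions\<close>

lemma comparison_map:
  assumes "minimal_bigraded_free_resolution I d g A" "minimal_bigraded_free_resolution I d' g' A'"
  obtains f where "\<And>u. homogeneous_mat (augmented_degrees d' u) (augmented_degrees d u) (f u)"
    "f 0 = 1\<^sub>m 1" "\<And>u. augmented_map g' A' u * f (Suc u) = f u * augmented_map g A u"
proof -
  interpret F: minimal_resolution I d g A by (rule minimal_resolution.intro[OF assms(1)])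
  interpret G: minimal_resolution I d' g' A' by (rule minimal_resolution.intro[OF assms(2)])
  \<comment> \<open>The invariant carries the solvability of the next lifting problem: the columns
    of \<open>f * F.\<delta> u\<close> lie in the image of \<open>G.\<delta> u\<close>. It holds at
    the start because both augmentations have image \<open>I\<close>, and it is passed on by
    exactness of the second complex.\<close>
  define Q where "Q u f \<longleftrightarrow> homogeneous_mat (G.D u) (F.D u) f \<and>
    (\<forall>t<length (d u). \<exists>w\<in>carrier_vec (length (d' u)). G.\<delta> u *\<^sub>v w = col (f * F.\<delta> u) t) \<and>
    (u = 0 \<longrightarrow> f = 1\<^sub>m 1)" for u f
  have "\<exists>f. \<forall>u. Q u (f u) \<and> G.\<delta> u * f (Suc u) = f u * F.\<delta> u"
  proof (rule dependent_nat_choice[of Q "\<lambda>u f h. G.\<delta> u * h = f * F.\<delta> u"])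
    have "\<exists>w\<in>carrier_vec (length (d' 0)). G.\<delta> 0 *\<^sub>v w = col (F.\<delta> 0) t" if "t < length (d 0)" for t
    proof -
      have c: "col (F.\<delta> 0) t \<in> carrier_vec 1"
        using carrier_matD(1)[OF F.carrier[of 0]]
        by (intro carrier_vecI) (simp add: augmented_degrees_def)
      have "F.\<delta> 0 *\<^sub>v unit_vec (length (d 0)) t = col (F.\<delta> 0) t"
        using that F.carrier[of 0] by (intro eq_vecI) auto
      then have "\<exists>v\<in>carrier_vec (length (d 0)). F.\<delta> 0 *\<^sub>v v = col (F.\<delta> 0) t"
        by (intro bexI[of _ "unit_vec (length (d 0)) t"]) auto
      then show ?thesis
        unfolding F.image_augmentation[OF c] G.image_augmentation[OF c] .
    qed
    moreover have "1\<^sub>m 1 * F.\<delta> 0 = F.\<delta> 0"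
      using F.carrier[of 0] by (simp add: augmented_degrees_def)
    ultimately have "Q 0 (1\<^sub>m 1)"
      using homogeneous_mat_one[of "[0]"] by (simp add: Q_def augmented_degrees_def)
    then show "\<exists>f. Q 0 f" ..
  next
    fix f u assume Q: "Q u f"
    have f: "homogeneous_mat (G.D u) (F.D u) f" using Q by (simp add: Q_def)
    note c = homogeneous_mat_carrier[OF f] F.carrier[of u] F.carrier_Suc[of u] G.carrier[of u]
    have im: "\<exists>w\<in>carrier_vec (length (d' u)). G.\<delta> u *\<^sub>v w = col (f * F.\<delta> u) t"
      if "t < length (d u)" for t
      using Q that by (simp add: Q_def)
    obtain h where h: "homogeneous_mat (d' u) (d u) h" "G.\<delta> u * h = f * F.\<delta> u"
      by (rule lift_homogeneous_mat[OF G.homogeneous_map homogeneous_mat_mult[OF f F.homogeneous_map] im])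
    note ch = homogeneous_mat_carrier[OF h(1)]
    have "G.\<delta> u * (h * F.\<delta> (Suc u)) = (G.\<delta> u * h) * F.\<delta> (Suc u)"
      by (rule assoc_mult_mat[OF c(4) ch c(3), symmetric])
    also have "\<dots> = f * (F.\<delta> u * F.\<delta> (Suc u))"
      unfolding h(2) by (rule assoc_mult_mat[OF c(1-3)])
    also have "\<dots> = 0\<^sub>m (length (G.D u)) (length (d (Suc u)))"
      using c by (simp add: F.map_map)
    finally have "G.\<delta> u * (h * F.\<delta> (Suc u)) = 0\<^sub>m (length (G.D u)) (length (d (Suc u)))" .
    from G.exact_image[OF mult_carrier_mat[OF ch F.carrier_Suc] this] h(1)
    have "Q (Suc u) h" unfolding Q_def by (simp del: col_mult2)
    with h(2) show "\<exists>h. Q (Suc u) h \<and> G.\<delta> u * h = f * F.\<delta> u" by (intro exI conjI)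
  qed
  then obtain f where f: "Q u (f u)" "G.\<delta> u * f (Suc u) = f u * F.\<delta> u" for u by blast
  show ?thesis
  proof (rule that[of f])
    show "homogeneous_mat (G.D u) (F.D u) (f u)" for u
      using f(1)[of u] unfolding Q_def by (elim conjE)
    show "f 0 = 1\<^sub>m 1"
      using f(1)[of 0] unfolding Q_def by (elim conjE) (erule mp, rule refl)
  qed (rule f(2))
qed

text \<open>An endomorphism of a minimal resolution that lifts the identity is homotopic to the identity,
  so it is the identity modulo the irrelevant ideal.\<close>

lemma (in minimal_resolution) endomorphism_const_coeff:
  assumes f: "\<And>u. f u \<in> carrier_mat (length (D u)) (length (D u))" "f 0 = 1\<^sub>m 1"
    and comm: "\<And>u. \<delta> u * f (Suc u) = f u * \<delta> u"
    and i: "i < length (d u)"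
  shows "const_coeff (f (Suc u) $$ (i, i)) = 1"
proof -
  have f': "f (Suc u) \<in> carrier_mat (length (d u)) (length (d u))" for u
    using f(1)[of "Suc u"] by simp
  \<comment> \<open>Minimality concerns only the maps between free modules: the augmentation may
    have unit entries. The last clause removes its contribution at \<open>u = 0\<close>, so that
    both summands of the homotopy vanish modulo the irrelevant ideal.\<close>
  have homotopy: "\<exists>h k. h \<in> carrier_mat (length (d (Suc u))) (length (d u)) \<and>
      k \<in> carrier_mat (length (d u)) (length (D u)) \<and>
      f (Suc u) - 1\<^sub>m (length (d u)) = \<delta> (Suc u) * h + k * \<delta> u \<and>
      (u = 0 \<longrightarrow> k = 0\<^sub>m (length (d u)) (length (D u)))" for u
  proof (induction u)
    case 0
    let ?n = "length (d 0)"
    let ?N = "f 1 - 1\<^sub>m ?n"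
    have N: "?N \<in> carrier_mat ?n ?n" using f'[of 0] by auto
    have "\<delta> 0 * ?N = \<delta> 0 * f 1 - \<delta> 0"
      using carrier[of 0] f'[of 0] by (simp add: mult_minus_distrib_mat)
    also have "\<dots> = 0\<^sub>m (length (D 0)) ?n"
      using comm[of 0] f(2) carrier[of 0] by (simp add: augmented_degrees_def)
    finally have "\<delta> 0 * ?N = 0\<^sub>m (length (D 0)) ?n" .
    from lift_mat[OF carrier_Suc N exact_image[OF N this]]
    obtain h where h: "h \<in> carrier_mat (length (d 1)) ?n" "\<delta> (Suc 0) * h = ?N" by auto
    moreover have "?N + 0\<^sub>m ?n (length (D 0)) * \<delta> 0 = ?N"
      using N carrier[of 0] by (simp add: left_mult_zero_mat)
    ultimately show ?case
      by (intro exI[of _ h] exI[of _ "0\<^sub>m ?n (length (D 0))"]) simp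
  next
    case (Suc u)
    let ?n = "length (d u)" and ?m = "length (d (Suc u))"
    obtain h k where h: "h \<in> carrier_mat ?m ?n" and k: "k \<in> carrier_mat ?n (length (D u))"
      and eq: "f (Suc u) - 1\<^sub>m ?n = \<delta> (Suc u) * h + k * \<delta> u" using Suc by blast
    let ?d = "\<delta> (Suc u)"
    note d = carrier_Suc[of u]
    have hd: "h * ?d \<in> carrier_mat ?m ?m" using h d by simp
    have f1: "f (Suc (Suc u)) - 1\<^sub>m ?m \<in> carrier_mat ?m ?m" by (simp add: minus_carrier_mat)
    \<comment> \<open>Subtracting \<open>h * ?d\<close> corrects the difference to a cycle, by the
      homotopy equation one level below. Exactness then provides the next \<open>h'\<close>.\<close>
    let ?N = "(f (Suc (Suc u)) - 1\<^sub>m ?m) - h * ?d"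
    have N: "?N \<in> carrier_mat ?m ?m" using hd by (simp add: minus_carrier_mat)
    have A: "?d * h * ?d \<in> carrier_mat ?n ?m" "k * \<delta> u * ?d \<in> carrier_mat ?n ?m"
      using d h k carrier[of u] by auto
    have "?d * ?N = ?d * (f (Suc (Suc u)) - 1\<^sub>m ?m) - ?d * (h * ?d)"
      by (rule mult_minus_distrib_mat[OF d f1 hd])
    also have "?d * (f (Suc (Suc u)) - 1\<^sub>m ?m) = ?d * f (Suc (Suc u)) - ?d"
      using d f'[of "Suc u"] by (simp add: mult_minus_distrib_mat)
    also have "\<dots> = (f (Suc u) - 1\<^sub>m ?n) * ?d"
      using comm[of "Suc u"] d f'[of u] by (simp add: minus_mult_distrib_mat)
    also have "\<dots> = ?d * h * ?d + k * \<delta> u * ?d"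
      unfolding eq using d h k carrier[of u] by (intro add_mult_distrib_mat) auto
    also have "k * \<delta> u * ?d = 0\<^sub>m ?n ?m"
      using assoc_mult_mat[OF k carrier[of u] d] k by (simp add: map_map)
    also have "?d * h * ?d + 0\<^sub>m ?n ?m - ?d * (h * ?d) = 0\<^sub>m ?n ?m"
      using A(1) assoc_mult_mat[OF d h d] by auto
    finally have "?d * ?N = 0\<^sub>m (length (D (Suc u))) ?m" by simp
    from lift_mat[OF carrier_Suc N exact_image[OF N this]]
    obtain h' where h': "h' \<in> carrier_mat (length (d (Suc (Suc u)))) ?m"
      "\<delta> (Suc (Suc u)) * h' = ?N" by auto
    have "f (Suc (Suc u)) - 1\<^sub>m ?m = ?N + h * ?d"
      using f'[of "Suc u"] hd by (intro eq_matI) (auto simp del: index_mult_mat(1))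
    with h' h show ?case by (intro exI[of _ h'] exI[of _ h]) auto
  qed
  obtain h k where h: "h \<in> carrier_mat (length (d (Suc u))) (length (d u))"
    and k: "k \<in> carrier_mat (length (d u)) (length (D u))"
    and eq: "f (Suc u) - 1\<^sub>m (length (d u)) = \<delta> (Suc u) * h + k * \<delta> u"
    and k0: "u = 0 \<Longrightarrow> k = 0\<^sub>m (length (d u)) (length (D u))"
    using homotopy[of u] by blast
  have "f (Suc u) $$ (i, i) - 1 = (f (Suc u) - 1\<^sub>m (length (d u))) $$ (i, i)"
    using f'[of u] i by simp
  also have "\<dots> = (\<delta> (Suc u) * h) $$ (i, i) + (k * \<delta> u) $$ (i, i)"
    unfolding eq using k carrier[of u] i by (simp del: index_mult_mat(1))
  finally have "const_coeff (f (Suc u) $$ (i, i)) - 1 =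
      const_coeff ((\<delta> (Suc u) * h) $$ (i, i)) + const_coeff ((k * \<delta> u) $$ (i, i))"
    by (metis lookup_add lookup_minus lookup_one_zero)
  also have "const_coeff ((\<delta> (Suc u) * h) $$ (i, i)) = 0"
    using i by (simp add: index_mult_mat_sum[OF carrier_Suc h] lookup_sum const_coeff_mult minimal del: index_mult_mat)
  also have "const_coeff ((k * \<delta> u) $$ (i, i)) = 0"
  proof (cases u)
    case 0
    then show ?thesis using k0 i carrier[of 0] by (simp add: left_mult_zero_mat)
  next
    case (Suc v)
    then show ?thesis
      using i minimal[of _ v i] index_mult_mat_sum[OF k carrier i i]
      by (simp add: lookup_sum const_coeff_mult del: index_mult_mat)
  qed
  finally show ?thesis by simp
qed

lemma count_list_eq_card_nth: "count_list xs x = card {i. i < length xs \<and> xs ! i = x}"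
  by (simp add: count_list_eq_length_filter length_filter_conv_card eq_commute)

text \<open>Comparison maps in both directions compose to the identity modulo the irrelevant ideal.
  In characteristic 0 the trace of this identity in a given degree recovers the rank, and
  the traces of the two compositions agree.\<close>

theorem count_minimal_resolution_unique:
  fixes I :: "'k::field_char_0 bipoly set"
  assumes "minimal_bigraded_free_resolution I d g A" "minimal_bigraded_free_resolution I d' g' A'"
  shows "count_list (d u) e = count_list (d' u) e"
proof -
  interpret F: minimal_resolution I d g A by (rule minimal_resolution.intro[OF assms(1)])
  interpret G: minimal_resolution I d' g' A' by (rule minimal_resolution.intro[OF assms(2)])
  obtain f where f: "\<And>u. homogeneous_mat (G.D u) (F.D u) (f u)"
    "f 0 = 1\<^sub>m 1" "\<And>u. G.\<delta> u * f (Suc u) = f u * F.\<delta> u"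
    by (rule comparison_map[OF assms]) blast
  obtain h where h: "\<And>u. homogeneous_mat (F.D u) (G.D u) (h u)"
    "h 0 = 1\<^sub>m 1" "\<And>u. F.\<delta> u * h (Suc u) = h u * G.\<delta> u"
    by (rule comparison_map[OF assms(2,1)]) blast
  note cf = homogeneous_mat_carrier[OF f(1)] and ch = homogeneous_mat_carrier[OF h(1)]
  have cf': "f (Suc u) \<in> carrier_mat (length (d' u)) (length (d u))"
    and ch': "h (Suc u) \<in> carrier_mat (length (d u)) (length (d' u))" for u
    using cf[of "Suc u"] ch[of "Suc u"] by simp_all
  have comp: "F.\<delta> u * (h (Suc u) * f (Suc u)) = h u * f u * F.\<delta> u" for u
    using assoc_mult_mat[OF F.carrier ch' cf', of u] assoc_mult_mat[OF ch G.carrier cf', of u]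
      assoc_mult_mat[OF ch cf F.carrier, of u]
    by (simp only: f(3) h(3))
  have comp': "G.\<delta> u * (f (Suc u) * h (Suc u)) = f u * h u * G.\<delta> u" for u
    using assoc_mult_mat[OF G.carrier cf' ch', of u] assoc_mult_mat[OF cf F.carrier ch', of u]
      assoc_mult_mat[OF cf ch G.carrier, of u]
    by (simp only: f(3) h(3))
  have tr: "const_coeff ((h (Suc u) * f (Suc u)) $$ (i, i)) = 1" if "i < length (d u)" for i
    by (rule F.endomorphism_const_coeff[of "\<lambda>u. h u * f u"])
      (use that comp f(2) h(2) in \<open>simp_all add: mult_carrier_mat[OF ch cf]\<close>)
  have tr': "const_coeff ((f (Suc u) * h (Suc u)) $$ (i, i)) = 1" if "i < length (d' u)" for i
    by (rule G.endomorphism_const_coeff[of "\<lambda>u. f u * h u"])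
      (use that comp' f(2) h(2) in \<open>simp_all add: mult_carrier_mat[OF cf ch]\<close>)
  let ?S = "{i. i < length (d u) \<and> d u ! i = e}" and ?S' = "{i. i < length (d' u) \<and> d' u ! i = e}"
  let ?f = "\<lambda>s t. const_coeff (f (Suc u) $$ (s, t))"
  let ?h = "\<lambda>s t. const_coeff (h (Suc u) $$ (s, t))"
  \<comment> \<open>An entry with nonzero constant coefficient has degree 0. So modulo the
    irrelevant ideal the comparison maps are block diagonal, with one block for each bidegree, and
    the trace argument can be carried out inside the block of \<open>e\<close>.\<close>
  have f0: "?f s t = 0" if "s < length (d' u)" "t < length (d u)" "d' u ! s \<noteq> d u ! t" for s t
    using f(1)[of "Suc u"] that const_coeff_bihomogeneous[of "d u ! t - d' u ! s"]
    by (fastforce simp: homogeneous_mat_def)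
  have "of_nat (card ?S) = (\<Sum>i\<in>?S. 1 :: 'k)" by simp
  also have "\<dots> = (\<Sum>i\<in>?S. \<Sum>j<length (d' u). ?h i j * ?f j i)"
  proof (rule sum.cong[OF refl])
    fix i assume "i \<in> ?S"
    then show "1 = (\<Sum>j<length (d' u). ?h i j * ?f j i)"
      using tr[of i] index_mult_mat_sum[OF ch' cf', of i u i]
      by (simp add: lookup_sum const_coeff_mult del: index_mult_mat)
  qed
  also have "\<dots> = (\<Sum>i\<in>?S. \<Sum>j\<in>?S'. ?h i j * ?f j i)"
    by (intro sum.cong[OF refl] sum.mono_neutral_right) (auto simp: f0)
  also have "\<dots> = (\<Sum>j\<in>?S'. \<Sum>i\<in>?S. ?f j i * ?h i j)"
    by (subst sum.swap) (simp add: mult.commute)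
  also have "\<dots> = (\<Sum>j\<in>?S'. \<Sum>i<length (d u). ?f j i * ?h i j)"
    by (intro sum.cong[OF refl] sum.mono_neutral_left) (auto, metis f0)
  also have "\<dots> = (\<Sum>j\<in>?S'. 1)"
  proof (rule sum.cong[OF refl])
    fix j assume "j \<in> ?S'"
    then show "(\<Sum>i<length (d u). ?f j i * ?h i j) = 1"
      using tr'[of j] index_mult_mat_sum[OF cf' ch', of j u j]
      by (simp add: lookup_sum const_coeff_mult del: index_mult_mat)
  qed
  also have "\<dots> = (of_nat (card ?S') :: 'k)" by simp
  finally show ?thesis by (simp add: count_list_eq_card_nth)
qed

corollary bigraded_betti_eq:
  fixes I :: "'k::field_char_0 bipoly set"
  assumes "minimal_bigraded_free_resolution I d g A"
  shows "bigraded_betti I u e = count_list (d u) e"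
  unfolding bigraded_betti_def
  using assms count_minimal_resolution_unique[OF _ assms] by (intro the_equality) blast+

section \<open>Linear changes of coordinates\<close>

lemma UNIV_4: "(UNIV :: 4 set) = {0, 1, 2, 3}"
proof -
  have "card {0, 1, 2, 3 :: 4} = card (UNIV :: 4 set)" by simp
  then show ?thesis by (intro card_subset_eq[symmetric]) auto
qed

lemma exhaust_4: "i = 0 \<or> i = 1 \<or> i = 2 \<or> i = (3 :: 4)"
  using UNIV_4 by blast

lemma scalar_0 [simp]: "scalar 0 = 0"
  by (simp add: scalar_def)

lemma scalar_1 [simp]: "scalar 1 = 1"
  by (simp add: scalar_def)

lemma scalar_add: "scalar (a + b) = scalar a + scalar b"
  by (simp add: scalar_def single_add)

lemma scalar_mult: "scalar (a * b) = scalar a * scalar b"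
  by (simp add: scalar_def mult_single)

lemma X_power: "X i ^ n = Poly_Mapping.single (Poly_Mapping.single i n) 1"
  by (induction n) (simp_all add: X_def mult_single single_add[symmetric])

lemma prod_X_power:
  "(\<Prod>i\<in>UNIV. X i ^ Poly_Mapping.lookup m i) = Poly_Mapping.single m (1 :: 'k::field)"
proof -
  have "(\<Prod>i\<in>A. X i ^ Poly_Mapping.lookup m i :: 'k bipoly) =
      Poly_Mapping.single (\<Sum>i\<in>A. Poly_Mapping.single i (Poly_Mapping.lookup m i)) 1" for A
    by (induction A rule: infinite_finite_induct) (simp_all add: X_power mult_single)
  moreover have "(\<Sum>i\<in>UNIV. Poly_Mapping.single i (Poly_Mapping.lookup m i)) = m"
    by (rule poly_mapping_eqI) (simp add: lookup_sum lookup_single when_def)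
  ultimately show ?thesis by simp
qed

section \<open>Substitution homomorphisms\<close>

definition poly_subst :: "(4 \<Rightarrow> 'k::field bipoly) \<Rightarrow> 'k bipoly \<Rightarrow> 'k bipoly" where
  "poly_subst L p = (\<Sum>m\<in>Poly_Mapping.keys p.
     scalar (Poly_Mapping.lookup p m) * (\<Prod>i\<in>UNIV. L i ^ Poly_Mapping.lookup m i))"

lemma poly_subst_superset:
  assumes "finite A" "Poly_Mapping.keys p \<subseteq> A"
  shows "poly_subst L p = (\<Sum>m\<in>A.
     scalar (Poly_Mapping.lookup p m) * (\<Prod>i\<in>UNIV. L i ^ Poly_Mapping.lookup m i))"
  unfolding poly_subst_def using assms
  by (intro sum.mono_neutral_left) (auto simp: in_keys_iff)

lemma poly_subst_0 [simp]: "poly_subst L 0 = 0"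
  by (simp add: poly_subst_def)

lemma poly_subst_add [simp]: "poly_subst L (p + q) = poly_subst L p + poly_subst L q"
proof -
  let ?A = "Poly_Mapping.keys p \<union> Poly_Mapping.keys q"
  have "Poly_Mapping.keys (p + q) \<subseteq> ?A" by (rule keys_add)
  then show ?thesis
    by (simp add: poly_subst_superset[of ?A] lookup_add scalar_add algebra_simps sum.distrib)
qed

lemma poly_subst_single:
  "poly_subst L (Poly_Mapping.single m c) =
     scalar c * (\<Prod>i\<in>UNIV. L i ^ Poly_Mapping.lookup m i)"
  by (simp add: poly_subst_def)

lemma poly_subst_scalar [simp]: "poly_subst L (scalar c) = scalar c"
  by (simp add: scalar_def poly_subst_single[unfolded scalar_def])

lemma poly_subst_1 [simp]: "poly_subst L 1 = 1"
  using poly_subst_scalar[of L 1] by simp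

lemma poly_subst_mult [simp]: "poly_subst L (p * q) = poly_subst L p * poly_subst L q"
proof (induction p rule: poly_mapping_monomial_induct)
  case (monomial m c)
  show ?case
  proof (induction q rule: poly_mapping_monomial_induct)
    case (monomial m' c')
    then show ?case
      by (simp add: mult_single poly_subst_single scalar_mult lookup_add power_add prod.distrib
          algebra_simps)
  qed (simp_all add: algebra_simps)
qed (simp_all add: algebra_simps)

lemma poly_subst_X [simp]: "poly_subst L (X i) = L i"
  by (simp add: X_def poly_subst_single lookup_single when_def if_distrib[of "\<lambda>n. _ ^ n"]
      prod.delta cong: if_cong)

lemma poly_subst_power: "poly_subst L (p ^ n) = poly_subst L p ^ n"
  by (induction n) auto

lemma poly_subst_prod: "poly_subst L (prod f A) = (\<Prod>i\<in>A. poly_subst L (f i))"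
  by (induction A rule: infinite_finite_induct) auto

lemma poly_subst_inverse:
  assumes "\<And>i. poly_subst L' (L i) = X i"
  shows "poly_subst L' (poly_subst L p) = p"
proof (induction p rule: poly_mapping_monomial_induct)
  case (monomial m c)
  show ?case
    by (simp add: poly_subst_single poly_subst_prod poly_subst_power assms prod_X_power)
      (simp add: scalar_def mult_single)
qed simp_all

lemma bihomogeneous_prod_powers:
  assumes "\<And>i. bihomogeneous (bidegree (Poly_Mapping.single i 1)) (L i)"
  shows "bihomogeneous (bidegree m) (\<Prod>i\<in>UNIV. L i ^ Poly_Mapping.lookup m i)"
proof -
  have pow: "bihomogeneous (bidegree (Poly_Mapping.single i n)) (L i ^ n)" for i n
  proof (induction n)
    case (Suc n)
    have "Poly_Mapping.single i (Suc n) = Poly_Mapping.single i 1 + Poly_Mapping.single i n"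
      by (simp add: single_add[symmetric])
    then show ?case using bihomogeneous_mult[OF assms Suc] by (simp add: bidegree_add)
  qed simp
  have "bihomogeneous (bidegree (\<Sum>i\<in>A. Poly_Mapping.single i (Poly_Mapping.lookup m i)))
      (\<Prod>i\<in>A. L i ^ Poly_Mapping.lookup m i)" for A
    by (induction A rule: infinite_finite_induct)
      (auto simp: bidegree_add intro!: bihomogeneous_mult pow)
  moreover have "(\<Sum>i\<in>UNIV. Poly_Mapping.single i (Poly_Mapping.lookup m i)) = m"
    by (rule poly_mapping_eqI) (simp add: lookup_sum lookup_single when_def)
  ultimately show ?thesis by metis
qed

lemma bihomogeneous_poly_subst:
  assumes "\<And>i. bihomogeneous (bidegree (Poly_Mapping.single i 1)) (L i)"
    and "bihomogeneous d p"
  shows "bihomogeneous d (poly_subst L p)"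
  unfolding poly_subst_def
proof (rule bihomogeneous_sum)
  fix m assume "m \<in> Poly_Mapping.keys p"
  then have m: "bidegree m = d" using assms(2) by (simp add: bihomogeneous_def)
  have "bihomogeneous 0 (scalar c)" for c :: 'a
    using bihomogeneous_single[of 0 c] by (simp add: scalar_def)
  from bihomogeneous_mult[OF this bihomogeneous_prod_powers[OF assms(1), of m]]
  show "bihomogeneous d
      (scalar (Poly_Mapping.lookup p m) * (\<Prod>i\<in>UNIV. L i ^ Poly_Mapping.lookup m i))"
    by (simp only: m add_0)
qed

section \<open>Transport of resolutions along an automorphism\<close>

locale bigraded_automorphism =
  fixes \<sigma> \<tau> :: "'k::field bipoly \<Rightarrow> 'k bipoly"
  assumes hom_add: "\<sigma> (p + q) = \<sigma> p + \<sigma> q" and hom_mult: "\<sigma> (p * q) = \<sigma> p * \<sigma> q"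
    and \<sigma>_\<tau>: "\<sigma> (\<tau> p) = p" and \<tau>_\<sigma>: "\<tau> (\<sigma> p) = p"
    and hom_bihomogeneous: "bihomogeneous d p \<Longrightarrow> bihomogeneous d (\<sigma> p)"
    and hom_irrelevant: "p \<in> generated_ideal (range X) \<Longrightarrow> \<sigma> p \<in> generated_ideal (range X)"
begin

lemma hom_zero: "\<sigma> 0 = 0"
  using hom_add[of 0 0] unfolding add_0 add_cancel_right_right .

lemma hom_eq_iff: "\<sigma> p = \<sigma> q \<longleftrightarrow> p = q"
  using \<tau>_\<sigma> by metis

lemma hom_sum: "\<sigma> (sum f A) = (\<Sum>i\<in>A. \<sigma> (f i))"
  by (induction A rule: infinite_finite_induct) (simp_all add: hom_add hom_zero)

lemma image_generated_ideal: "\<sigma> ` generated_ideal S = generated_ideal (\<sigma> ` S)"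
proof (intro equalityI subsetI)
  fix y assume "y \<in> \<sigma> ` generated_ideal S"
  then obtain x where "x \<in> generated_ideal S" "y = \<sigma> x" by blast
  from this(1) show "y \<in> generated_ideal (\<sigma> ` S)"
    unfolding \<open>y = \<sigma> x\<close>
    by (induction rule: generated_ideal_induct)
      (auto simp: hom_add hom_mult hom_zero generated_ideal_0
        intro!: generated_ideal_add generated_ideal_mult intro: generated_ideal_base)
next
  fix y assume "y \<in> generated_ideal (\<sigma> ` S)"
  then show "y \<in> \<sigma> ` generated_ideal S"
  proof (induction rule: generated_ideal_induct)
    case zero
    show ?case by (metis hom_zero generated_ideal_0 imageI)
  next
    case (base_add c x y)
    then obtain x' y' where "x = \<sigma> x'" "x' \<in> S" "y = \<sigma> y'" "y' \<in> generated_ideal S" by blast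
    then have "c * x + y = \<sigma> (\<tau> c * x' + y')" "\<tau> c * x' + y' \<in> generated_ideal S"
      by (auto simp: hom_add hom_mult \<sigma>_\<tau>
          intro!: generated_ideal_add generated_ideal_mult intro: generated_ideal_base)
    then show ?case by blast
  qed
qed

lemma image_ideal_power: "\<sigma> ` ideal_power I n = ideal_power (\<sigma> ` I) n"
proof (induction n)
  case 0
  have "surj \<sigma>" using \<sigma>_\<tau> by (rule surjI)
  then show ?case by simp
next
  case (Suc n)
  have "\<sigma> ` {x * y | x y. x \<in> I \<and> y \<in> ideal_power I n} =
      {x * y | x y. x \<in> \<sigma> ` I \<and> y \<in> \<sigma> ` ideal_power I n}"
  proof (intro equalityI subsetI)
    fix z assume "z \<in> {x * y | x y. x \<in> \<sigma> ` I \<and> y \<in> \<sigma> ` ideal_power I n}"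
    then obtain x y where "z = \<sigma> (x * y)" "x \<in> I" "y \<in> ideal_power I n"
      by (auto simp: hom_mult)
    then show "z \<in> \<sigma> ` {x * y | x y. x \<in> I \<and> y \<in> ideal_power I n}" by blast
  next
    fix z assume "z \<in> \<sigma> ` {x * y | x y. x \<in> I \<and> y \<in> ideal_power I n}"
    then obtain x y where "z = \<sigma> x * \<sigma> y" "x \<in> I" "y \<in> ideal_power I n"
      by (auto simp: hom_mult)
    then show "z \<in> {x * y | x y. x \<in> \<sigma> ` I \<and> y \<in> \<sigma> ` ideal_power I n}" by blast
  qed
  with Suc show ?case by (simp add: image_generated_ideal)
qed

lemma image_fat_points_ideal:
  "\<sigma> ` fat_points_ideal H1 H2 V1 V2 m11 m12 m21 =
   fat_points_ideal (\<sigma> H1) (\<sigma> H2) (\<sigma> V1) (\<sigma> V2) m11 m12 m21"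
proof -
  have "inj \<sigma>" by (simp add: inj_def hom_eq_iff)
  then show ?thesis
    by (simp add: fat_points_ideal_def image_Int image_ideal_power image_generated_ideal)
qed

lemma map_vec_surj:
  assumes "v \<in> carrier_vec n"
  obtains w where "w \<in> carrier_vec n" "v = map_vec \<sigma> w"
proof
  show "map_vec \<tau> v \<in> carrier_vec n" using assms by simp
  show "v = map_vec \<sigma> (map_vec \<tau> v)" by (intro eq_vecI) (auto simp: \<sigma>_\<tau>)
qed

lemma image_map_vec_eq:
  assumes "\<And>w. w \<in> carrier_vec n \<Longrightarrow> P (map_vec \<sigma> w) \<longleftrightarrow> Q w"
  shows "{v \<in> carrier_vec n. P v} = map_vec \<sigma> ` {w \<in> carrier_vec n. Q w}"
proof (intro equalityI subsetI)
  fix v assume v: "v \<in> {v \<in> carrier_vec n. P v}"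
  then obtain w where "w \<in> carrier_vec n" "v = map_vec \<sigma> w" using map_vec_surj by blast
  then show "v \<in> map_vec \<sigma> ` {w \<in> carrier_vec n. Q w}" using v assms by blast
qed (use assms in auto)

lemma image_map_vec_Collect:
  assumes "\<And>w. w \<in> carrier_vec n \<Longrightarrow> F (map_vec \<sigma> w) = h (G w)"
  shows "{F v | v. v \<in> carrier_vec n} = h ` {G w | w. w \<in> carrier_vec n}"
proof (intro equalityI subsetI)
  fix y assume "y \<in> {F v | v. v \<in> carrier_vec n}"
  then obtain v where "y = F v" "v \<in> carrier_vec n" by blast
  then obtain w where "w \<in> carrier_vec n" "y = F (map_vec \<sigma> w)" using map_vec_surj by metis
  then show "y \<in> h ` {G w | w. w \<in> carrier_vec n}" using assms by blast
next
  fix y assume "y \<in> h ` {G w | w. w \<in> carrier_vec n}"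
  then obtain w where "y = h (G w)" "w \<in> carrier_vec n" by blast
  then show "y \<in> {F v | v. v \<in> carrier_vec n}"
    using assms[of w] map_carrier_vec by (intro CollectI exI[of _ "map_vec \<sigma> w"]) auto
qed

lemma hom_scalar_prod:
  "v \<in> carrier_vec n \<Longrightarrow> w \<in> carrier_vec n \<Longrightarrow> map_vec \<sigma> v \<bullet> map_vec \<sigma> w = \<sigma> (v \<bullet> w)"
  by (auto simp: scalar_prod_def hom_sum hom_mult intro!: sum.cong)

lemma hom_mult_mat_vec:
  assumes "M \<in> carrier_mat n m" "w \<in> carrier_vec m"
  shows "map_mat \<sigma> M *\<^sub>v map_vec \<sigma> w = map_vec \<sigma> (M *\<^sub>v w)"
proof (rule eq_vecI)
  fix i assume "i < dim_vec (map_vec \<sigma> (M *\<^sub>v w))"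
  then have i: "i < n" using assms by simp
  have "row (map_mat \<sigma> M) i = map_vec \<sigma> (row M i)"
    using assms i by (intro eq_vecI) auto
  then show "(map_mat \<sigma> M *\<^sub>v map_vec \<sigma> w) $ i = map_vec \<sigma> (M *\<^sub>v w) $ i"
    using assms i hom_scalar_prod[of "row M i" m w] by simp
qed (use assms in auto)

lemma map_vec_eq_zero_iff: "map_vec \<sigma> v = 0\<^sub>v n \<longleftrightarrow> v = 0\<^sub>v n"
  using hom_eq_iff[of _ 0] by (auto simp: vec_eq_iff hom_zero)

text \<open>Apply \<open>\<sigma>\<close> to every matrix entry. As \<open>\<sigma>\<close> is a
  bijective ring homomorphism, \<open>map_vec \<sigma>\<close> carries kernels to kernels and images
  to images; preservation of bidegrees and of the irrelevant ideal keeps homogeneity and minimality.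
  The list of degrees stays the same.\<close>

theorem minimal_resolution_image:
  assumes "minimal_bigraded_free_resolution I d g A"
  shows "minimal_bigraded_free_resolution (\<sigma> ` I) d (map_vec \<sigma> g) (\<lambda>u. map_mat \<sigma> (A u))"
proof -
  have r1: "\<forall>u > 2. d u = []" and g: "g \<in> carrier_vec (length (d 0))"
    and A0: "\<forall>u \<ge> 1. A u \<in> carrier_mat (length (d (u - 1))) (length (d u))"
    and hg: "\<forall>s < length (d 0). bihomogeneous (d 0 ! s) (g $ s)"
    and hA: "\<forall>u \<ge> 1. \<forall>s < length (d (u - 1)). \<forall>t < length (d u).
        bihomogeneous (d u ! t - d (u - 1) ! s) (A u $$ (s, t))"
    and im: "{g \<bullet> v | v. v \<in> carrier_vec (length (d 0))} = I"
    and e0: "{v \<in> carrier_vec (length (d 0)). g \<bullet> v = 0} =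
       {A 1 *\<^sub>v w | w. w \<in> carrier_vec (length (d 1))}"
    and e1: "\<forall>u \<ge> 1. {v \<in> carrier_vec (length (d u)). A u *\<^sub>v v = 0\<^sub>v (length (d (u - 1)))} =
        {A (u + 1) *\<^sub>v w | w. w \<in> carrier_vec (length (d (u + 1)))}"
    and min: "\<forall>u \<ge> 1. \<forall>s < length (d (u - 1)). \<forall>t < length (d u).
        A u $$ (s, t) \<in> generated_ideal (range X)"
    using assms unfolding minimal_bigraded_free_resolution_def by - ((elim conjE, assumption)+)
  note A = A0[rule_format]
  have img: "{map_mat \<sigma> (A u) *\<^sub>v w | w. w \<in> carrier_vec (length (d u))} =
      map_vec \<sigma> ` {A u *\<^sub>v w | w. w \<in> carrier_vec (length (d u))}" if "u \<ge> 1" for u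
    by (rule image_map_vec_Collect) (rule hom_mult_mat_vec[OF A[OF that]])
  have idx: "map_mat \<sigma> (A u) $$ (s, t) = \<sigma> (A u $$ (s, t))"
    if "u \<ge> 1" "s < length (d (u - 1))" "t < length (d u)" for u s t
    using A[OF that(1)] that by (intro index_map_mat(1)) simp_all
  show ?thesis
    unfolding minimal_bigraded_free_resolution_def
  proof (intro conjI allI impI)
    show "{map_vec \<sigma> g \<bullet> v | v. v \<in> carrier_vec (length (d 0))} = \<sigma> ` I"
      unfolding im[symmetric] by (rule image_map_vec_Collect) (rule hom_scalar_prod[OF g])
    have "{v \<in> carrier_vec (length (d 0)). map_vec \<sigma> g \<bullet> v = 0} =
        map_vec \<sigma> ` {v \<in> carrier_vec (length (d 0)). g \<bullet> v = 0}"
      by (rule image_map_vec_eq) (metis hom_scalar_prod[OF g] hom_eq_iff hom_zero)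
    then show "{v \<in> carrier_vec (length (d 0)). map_vec \<sigma> g \<bullet> v = 0} =
        {map_mat \<sigma> (A 1) *\<^sub>v w | w. w \<in> carrier_vec (length (d 1))}"
      unfolding e0 img[OF order_refl] .
  next
    fix u :: nat assume u: "1 \<le> u"
    have "{v \<in> carrier_vec (length (d u)). map_mat \<sigma> (A u) *\<^sub>v v = 0\<^sub>v (length (d (u - 1)))} =
        map_vec \<sigma> ` {v \<in> carrier_vec (length (d u)). A u *\<^sub>v v = 0\<^sub>v (length (d (u - 1)))}"
      by (rule image_map_vec_eq) (simp only: hom_mult_mat_vec[OF A[OF u]] map_vec_eq_zero_iff)
    then show "{v \<in> carrier_vec (length (d u)). map_mat \<sigma> (A u) *\<^sub>v v = 0\<^sub>v (length (d (u - 1)))} =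
        {map_mat \<sigma> (A (u + 1)) *\<^sub>v w | w. w \<in> carrier_vec (length (d (u + 1)))}"
      unfolding e1[rule_format, OF u] img[OF le_add2] .
  next
    fix u s t assume *: "1 \<le> u" "s < length (d (u - 1))" "t < length (d u)"
    show "bihomogeneous (d u ! t - d (u - 1) ! s) (map_mat \<sigma> (A u) $$ (s, t))"
      unfolding idx[OF *] by (rule hom_bihomogeneous[OF hA[rule_format, OF *]])
    show "map_mat \<sigma> (A u) $$ (s, t) \<in> generated_ideal (range X)"
      unfolding idx[OF *] by (rule hom_irrelevant[OF min[rule_format, OF *]])
  next
    fix s assume s: "s < length (d 0)"
    have "map_vec \<sigma> g $ s = \<sigma> (g $ s)" using g s by simp
    then show "bihomogeneous (d 0 ! s) (map_vec \<sigma> g $ s)"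
      using hom_bihomogeneous[OF hg[rule_format, OF s]] by simp
  next
    show "map_mat \<sigma> (A u) \<in> carrier_mat (length (d (u - 1))) (length (d u))" if "1 \<le> u" for u
      using A[OF that] by (simp only: map_carrier_mat)
  next
    show "d u = []" if "2 < u" for u using r1 that by (simp only:)
  next
    show "map_vec \<sigma> g \<in> carrier_vec (length (d 0))" using g by (simp only: map_carrier_vec)
  qed
qed

end

section \<open>Construction of the coordinate change\<close>

lemma two_by_two_inverse:
  fixes a b c d :: "'k::field"
  assumes "a * d \<noteq> b * c"
  obtains a' b' c' d' where "a' * a + b' * c = 1" "a' * b + b' * d = 0"
    "c' * a + d' * c = 0" "c' * b + d' * d = 1"
    "a * a' + b * c' = 1" "a * b' + b * d' = 0" "c * a' + d * c' = 0" "c * b' + d * d' = 1"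
proof -
  define D where "D = a * d - b * c"
  have "D \<noteq> 0" using assms by (simp add: D_def)
  then show ?thesis
    by (intro that[of "d / D" "- b / D" "- c / D" "a / D"])
      (simp_all add: divide_simps, simp_all add: D_def algebra_simps)
qed

lemma linear_form_eq:
  assumes "Poly_Mapping.keys H \<subseteq> {Poly_Mapping.single i 1, Poly_Mapping.single j 1}" "i \<noteq> j"
  obtains a b where "H = scalar a * X i + scalar b * X j"
proof
  have [simp]: "Poly_Mapping.single i (Suc 0) \<noteq> Poly_Mapping.single j (Suc 0)"
    using assms(2) by (metis lookup_single_eq lookup_single_not_eq nat.distinct(1))
  let ?K = "{Poly_Mapping.single i (1::nat), Poly_Mapping.single j 1}"
  have "H = (\<Sum>m\<in>?K. Poly_Mapping.single m (Poly_Mapping.lookup H m))"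
    by (subst poly_mapping_sum_monomials[symmetric], rule sum.mono_neutral_left)
      (use assms(1) in \<open>auto simp: in_keys_iff\<close>)
  then show "H = scalar (Poly_Mapping.lookup H (Poly_Mapping.single i 1)) * X i +
      scalar (Poly_Mapping.lookup H (Poly_Mapping.single j 1)) * X j"
    by (simp add: scalar_def X_def mult_single)
qed

text \<open>Non-proportionality makes the coefficient determinant nonzero. The equations for
  \<open>X i\<close> and \<open>X j\<close> express that substituting the forms inverts the dual
  forms, the last two that the inversion also works in the other order. Both are needed for an
  automorphism.\<close>

lemma dual_linear_forms:
  assumes "Poly_Mapping.keys H \<subseteq> {Poly_Mapping.single i 1, Poly_Mapping.single j 1}"
    and "Poly_Mapping.keys H' \<subseteq> {Poly_Mapping.single i 1, Poly_Mapping.single j 1}"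
    and "i \<noteq> j" "H' \<noteq> 0" "\<nexists>c. H = scalar c * H'"
  obtains a b c d a' b' c' d' where
    "H = scalar a * X i + scalar b * X j" "H' = scalar c * X i + scalar d * X j"
    "X i = scalar a' * H + scalar b' * H'" "X j = scalar c' * H + scalar d' * H'"
    "scalar a * (scalar a' * X i + scalar b' * X j) + scalar b * (scalar c' * X i + scalar d' * X j) = X i"
    "scalar c * (scalar a' * X i + scalar b' * X j) + scalar d * (scalar c' * X i + scalar d' * X j) = X j"
proof -
  obtain a b where H: "H = scalar a * X i + scalar b * X j"
    using linear_form_eq[OF assms(1,3)] .
  obtain c d where H': "H' = scalar c * X i + scalar d * X j"
    using linear_form_eq[OF assms(2,3)] .
  have comb: "scalar r * (scalar p * X i + scalar q * X j) + scalar s * (scalar t * X i + scalar u * X j) =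
      scalar (r * p + s * t) * X i + scalar (r * q + s * u) * (X j :: 'a bipoly)" for r p q s t u
    by (simp add: scalar_add scalar_mult algebra_simps)
  have "a * d \<noteq> b * c"
  proof
    assume eq: "a * d = b * c"
    have "c \<noteq> 0 \<or> d \<noteq> 0" using assms(4) H' by auto
    then have "\<exists>e. a = e * c \<and> b = e * d"
    proof
      assume "c \<noteq> 0"
      with eq show ?thesis by (intro exI[of _ "a / c"]) (simp add: field_simps)
    next
      assume "d \<noteq> 0"
      with eq show ?thesis by (intro exI[of _ "b / d"]) (simp add: field_simps)
    qed
    then obtain e where "a = e * c" "b = e * d" by blast
    then have "H = scalar e * H'" unfolding H H' by (simp add: scalar_mult algebra_simps)
    with assms(5) show False by blast
  qed
  from two_by_two_inverse[OF this] obtain a' b' c' d' where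
    "a' * a + b' * c = 1" "a' * b + b' * d = 0"
    "c' * a + d' * c = 0" "c' * b + d' * d = 1"
    "a * a' + b * c' = 1" "a * b' + b * d' = 0" "c * a' + d * c' = 0" "c * b' + d * d' = 1" .
  then show ?thesis
    by (intro that[OF H H', of a' b' c' d']) (simp_all add: H H' comb)
qed

lemma bidegree_single: "bidegree (Poly_Mapping.single i n) =
  (if i = 0 \<or> i = 1 then (int n, 0) else (0, int n))"
  using exhaust_4[of i] by (elim disjE) (simp_all add: bidegree_def lookup_single when_def)

lemma exponents_eqI:
  fixes m n :: "4 \<Rightarrow>\<^sub>0 nat"
  assumes "Poly_Mapping.lookup m 0 = Poly_Mapping.lookup n 0" "Poly_Mapping.lookup m 1 = Poly_Mapping.lookup n 1"
    "Poly_Mapping.lookup m 2 = Poly_Mapping.lookup n 2" "Poly_Mapping.lookup m 3 = Poly_Mapping.lookup n 3"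
  shows "m = n"
proof (rule poly_mapping_eqI)
  fix i show "Poly_Mapping.lookup m i = Poly_Mapping.lookup n i"
    using exhaust_4[of i] assms by (elim disjE) simp_all
qed

lemma bidegree_eq_1_0:
  assumes "bidegree m = (1, 0)"
  shows "m \<in> {Poly_Mapping.single 0 1, Poly_Mapping.single 1 1}"
proof (cases "Poly_Mapping.lookup m 0 = 0")
  case True
  then have "m = Poly_Mapping.single 1 1"
    using assms by (intro exponents_eqI) (simp_all add: bidegree_def lookup_single)
  then show ?thesis by simp
next
  case False
  then have "m = Poly_Mapping.single 0 1"
    using assms by (intro exponents_eqI) (simp_all add: bidegree_def lookup_single)
  then show ?thesis by simp
qed

lemma bidegree_eq_0_1:
  assumes "bidegree m = (0, 1)"
  shows "m \<in> {Poly_Mapping.single 2 1, Poly_Mapping.single 3 1}"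
proof (cases "Poly_Mapping.lookup m 2 = 0")
  case True
  then have "m = Poly_Mapping.single 3 1"
    using assms by (intro exponents_eqI) (simp_all add: bidegree_def lookup_single)
  then show ?thesis by simp
next
  case False
  then have "m = Poly_Mapping.single 2 1"
    using assms by (intro exponents_eqI) (simp_all add: bidegree_def lookup_single)
  then show ?thesis by simp
qed

theorem coordinate_change:
  fixes H1 H2 V1 V2 :: "'k::field bipoly"
  assumes "bihomogeneous (1, 0) H1" "bihomogeneous (1, 0) H2"
    and "H2 \<noteq> 0" "\<nexists>c. H1 = scalar c * H2"
    and "bihomogeneous (0, 1) V1" "bihomogeneous (0, 1) V2"
    and "V2 \<noteq> 0" "\<nexists>c. V1 = scalar c * V2"
  obtains \<sigma> \<tau> where "bigraded_automorphism \<sigma> \<tau>"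
    "\<sigma> (X 0) = H1" "\<sigma> (X 1) = H2" "\<sigma> (X 2) = V1" "\<sigma> (X 3) = V2"
proof -
  have kH: "Poly_Mapping.keys H1 \<subseteq> {Poly_Mapping.single 0 1, Poly_Mapping.single 1 1}"
    "Poly_Mapping.keys H2 \<subseteq> {Poly_Mapping.single 0 1, Poly_Mapping.single 1 1}"
    using assms(1,2) bidegree_eq_1_0 unfolding bihomogeneous_def by blast+
  have kV: "Poly_Mapping.keys V1 \<subseteq> {Poly_Mapping.single 2 1, Poly_Mapping.single 3 1}"
    "Poly_Mapping.keys V2 \<subseteq> {Poly_Mapping.single 2 1, Poly_Mapping.single 3 1}"
    using assms(5,6) bidegree_eq_0_1 unfolding bihomogeneous_def by blast+
  have ne: "(0::4) \<noteq> 1" "(2::4) \<noteq> 3" by simp_all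
  from dual_linear_forms[OF kH ne(1) assms(3,4)] obtain a b c d a' b' c' d' where H:
    "H1 = scalar a * X 0 + scalar b * X 1" "H2 = scalar c * X 0 + scalar d * X 1"
    "X 0 = scalar a' * H1 + scalar b' * H2" "X 1 = scalar c' * H1 + scalar d' * H2"
    "scalar a * (scalar a' * X 0 + scalar b' * X 1) + scalar b * (scalar c' * X 0 + scalar d' * X 1) = X 0"
    "scalar c * (scalar a' * X 0 + scalar b' * X 1) + scalar d * (scalar c' * X 0 + scalar d' * X 1) = X 1" .
  from dual_linear_forms[OF kV ne(2) assms(7,8)] obtain e f g h e' f' g' h' where V:
    "V1 = scalar e * X 2 + scalar f * X 3" "V2 = scalar g * X 2 + scalar h * X 3"
    "X 2 = scalar e' * V1 + scalar f' * V2" "X 3 = scalar g' * V1 + scalar h' * V2"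
    "scalar e * (scalar e' * X 2 + scalar f' * X 3) + scalar f * (scalar g' * X 2 + scalar h' * X 3) = X 2"
    "scalar g * (scalar e' * X 2 + scalar f' * X 3) + scalar h * (scalar g' * X 2 + scalar h' * X 3) = X 3" .
  define L where "L = (\<lambda>i::4. if i = 0 then H1 else if i = 1 then H2 else if i = 2 then V1 else V2)"
  define L' where "L' = (\<lambda>i::4. if i = 0 then scalar a' * X 0 + scalar b' * X 1
    else if i = 1 then scalar c' * X 0 + scalar d' * X 1
    else if i = 2 then scalar e' * X 2 + scalar f' * X 3 else scalar g' * X 2 + scalar h' * X 3 :: 'k bipoly)"
  have L: "L 0 = H1" "L 1 = H2" "L 2 = V1" "L 3 = V2" by (simp_all add: L_def)
  have L': "L' 0 = scalar a' * X 0 + scalar b' * X 1" "L' 1 = scalar c' * X 0 + scalar d' * X 1"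
    "L' 2 = scalar e' * X 2 + scalar f' * X 3" "L' 3 = scalar g' * X 2 + scalar h' * X 3"
    by (simp_all add: L'_def)
  have L'L: "poly_subst L' (L i) = X i" for i
    using exhaust_4[of i]
    by (elim disjE; hypsubst)
      (simp_all only: L H(1,2) V(1,2) poly_subst_add poly_subst_mult poly_subst_scalar poly_subst_X
        L' H(5,6) V(5,6))
  have LL': "poly_subst L (L' i) = X i" for i
    using exhaust_4[of i]
    by (elim disjE; hypsubst)
      (simp_all only: L' poly_subst_add poly_subst_mult poly_subst_scalar poly_subst_X L
        H(3,4)[symmetric] V(3,4)[symmetric])
  have hom: "bihomogeneous (bidegree (Poly_Mapping.single i 1)) (L i)" for i
    using exhaust_4[of i]
    by (elim disjE; hypsubst) (simp_all add: L bidegree_single assms)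
  have irr: "L i \<in> generated_ideal (range X)" for i
    using exhaust_4[of i]
    by (elim disjE; hypsubst) (simp_all only: L H(1,2) V(1,2) generated_ideal_add
        generated_ideal_mult generated_ideal_base rangeI)
  have "bigraded_automorphism (poly_subst L) (poly_subst L')"
  proof
    fix p :: "'k bipoly" assume "p \<in> generated_ideal (range X)"
    then show "poly_subst L p \<in> generated_ideal (range X)"
      by (induction rule: generated_ideal_induct)
        (auto intro!: generated_ideal_add generated_ideal_mult generated_ideal_0 irr)
  next
    fix d and p :: "'k bipoly" assume "bihomogeneous d p"
    then show "bihomogeneous d (poly_subst L p)" by (rule bihomogeneous_poly_subst[OF hom])
  qed (simp_all add: poly_subst_inverse L'L LL')
  then show ?thesis
    by (rule that) (simp_all add: L)
qed

section \<open>Monomial ideals\<close>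

abbreviation expo :: "(4 \<Rightarrow>\<^sub>0 nat) \<Rightarrow> 4 \<Rightarrow> nat" where
  "expo \<equiv> Poly_Mapping.lookup"

lemma monomial_factor:
  assumes "1 \<le> expo m i"
  obtains n where "m = Poly_Mapping.single i 1 + n" "\<And>c. Poly_Mapping.single m c = X i * Poly_Mapping.single n c"
proof -
  let ?n = "m - Poly_Mapping.single i 1"
  have "m = Poly_Mapping.single i 1 + ?n"
    by (rule poly_mapping_eqI)
      (use assms in \<open>auto simp: lookup_add lookup_minus lookup_single when_def\<close>)
  moreover have "Poly_Mapping.single (Poly_Mapping.single i 1 + ?n) c = X i * Poly_Mapping.single ?n c" for c
    by (simp add: X_def mult_single)
  ultimately show ?thesis using that[of ?n] by metis
qed

lemma keys_X_times:
  "Poly_Mapping.keys (X i * p) = (+) (Poly_Mapping.single i 1) ` Poly_Mapping.keys (p :: 'k::field bipoly)"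
  unfolding X_def by (simp add: keys_single_times)

lemma X_neq_0 [simp]: "X i \<noteq> (0 :: 'k::field bipoly)"
  by (metis X_def lookup_single_eq lookup_zero one_neq_zero)

lemma keys_times_cases:
  assumes "m \<in> Poly_Mapping.keys (p * q)"
  obtains m1 m2 where "m = m1 + m2" "m1 \<in> Poly_Mapping.keys p" "m2 \<in> Poly_Mapping.keys q"
  using assms keys_mult[of p q] by blast

lemma keys_plus_cases:
  assumes "m \<in> Poly_Mapping.keys (p + q)"
  shows "m \<in> Poly_Mapping.keys p \<or> m \<in> Poly_Mapping.keys q"
  using assms keys_add[of p q] by blast

lemma generated_ideal_vars_keys:
  assumes "p \<in> generated_ideal {X i, X j :: 'k::field bipoly}" "m \<in> Poly_Mapping.keys p"
  shows "1 \<le> expo m i + expo m j"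
  using assms
proof (induction arbitrary: m rule: generated_ideal_induct)
  case (base_add c x y)
  from keys_plus_cases[OF base_add.prems] show ?case
  proof
    assume "m \<in> Poly_Mapping.keys (c * x)"
    then obtain m1 m2 where "m = m1 + m2" "m2 \<in> Poly_Mapping.keys x"
      by (rule keys_times_cases)
    then show ?thesis using base_add.hyps by (auto simp: X_def lookup_add)
  qed (rule base_add.IH)
qed simp

text \<open>For distinct \<open>i\<close> and \<open>j\<close>, dividing a monomial by one of the
  two variables lowers the sum of their exponents by exactly one, so a monomial with sum at least
  \<open>Suc n\<close> splits off a generator and leaves one with sum at least
  \<open>n\<close>.\<close>

lemma ideal_power_two_vars:
  assumes "i \<noteq> j"
  shows "ideal_power (generated_ideal {X i, X j :: 'k::field bipoly}) n =
    {p. \<forall>m\<in>Poly_Mapping.keys p. n \<le> expo m i + expo m j}"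
proof (induction n)
  case (Suc n)
  let ?I = "generated_ideal {X i, X j :: 'k bipoly}" and ?P = "\<lambda>n. {p :: 'k bipoly. \<forall>m\<in>Poly_Mapping.keys p. n \<le> expo m i + expo m j}"
  have "p \<in> ?P (Suc n)" if "p \<in> generated_ideal {x * y | x y. x \<in> ?I \<and> y \<in> ?P n}" for p
    using that
  proof (induction rule: generated_ideal_induct)
    case (base_add c z p)
    obtain x y where z: "z = x * y" "x \<in> ?I" "y \<in> ?P n" using base_add.hyps by blast
    have "Suc n \<le> expo m i + expo m j" if m: "m \<in> Poly_Mapping.keys (c * z + p)" for m
      using keys_plus_cases[OF m]
    proof
      assume "m \<in> Poly_Mapping.keys (c * z)"
      then obtain m0 m' where m': "m = m0 + m'" "m' \<in> Poly_Mapping.keys (x * y)"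
        unfolding z(1) by (rule keys_times_cases)
      from m'(2) obtain m1 m2 where m12: "m' = m1 + m2" "m1 \<in> Poly_Mapping.keys x" "m2 \<in> Poly_Mapping.keys y"
        by (rule keys_times_cases)
      have "1 \<le> expo m1 i + expo m1 j" using generated_ideal_vars_keys[OF z(2) m12(2)] .
      moreover have "n \<le> expo m2 i + expo m2 j" using z(3) m12(3) by blast
      ultimately show ?thesis by (simp add: m' m12 lookup_add)
    qed (use base_add.IH in blast)
    then show ?case by blast
  qed simp
  moreover have "p \<in> generated_ideal {x * y | x y. x \<in> ?I \<and> y \<in> ?P n}" if p: "p \<in> ?P (Suc n)" for p
  proof -
    have "Poly_Mapping.single m (Poly_Mapping.lookup p m) \<in> generated_ideal {x * y | x y. x \<in> ?I \<and> y \<in> ?P n}"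
      if "m \<in> Poly_Mapping.keys p" for m
    proof -
      have m: "Suc n \<le> expo m i + expo m j" using p that by blast
      have "1 \<le> expo m i \<or> 1 \<le> expo m j" using m by auto
      then obtain k where k: "k = i \<or> k = j" "1 \<le> expo m k" by blast
      from k(2) obtain m' where m': "m = Poly_Mapping.single k 1 + m'"
        "\<And>c. Poly_Mapping.single m c = X k * Poly_Mapping.single m' (c :: 'k)"
        by (rule monomial_factor) blast
      have "n \<le> expo m' i + expo m' j"
        using m k(1) assms by (auto simp: m'(1) lookup_add lookup_single when_def)
      then have "Poly_Mapping.single m' c \<in> ?P n" for c :: 'k by simp
      moreover have "X k \<in> ?I" using k(1) by (auto intro: generated_ideal_base)
      ultimately show ?thesis unfolding m'(2) by (intro generated_ideal_base) blast
    qed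
    then show ?thesis
      by (subst poly_mapping_sum_monomials[symmetric]) (rule generated_ideal_sum)
  qed
  ultimately show ?case by (auto simp: Suc)
qed simp

lemma fat_points_ideal_coordinates:
  "fat_points_ideal (X 0) (X 1) (X 2) (X 3 :: 'k::field bipoly) p q r =
    {f. \<forall>m\<in>Poly_Mapping.keys f. p \<le> expo m 0 + expo m 2 \<and> q \<le> expo m 0 + expo m 3 \<and> r \<le> expo m 1 + expo m 2}"
  by (auto simp: fat_points_ideal_def ideal_power_two_vars)

text \<open>The flags \<open>A\<close> and \<open>B\<close> tell which of the two variables may be
  used. In the exactness proof they say whether an edge leaves the vertex in the respective
  direction, so a part that vanishes by its flag respects the support conditions.\<close>

lemma split_by_variables:
  fixes p :: "'k::field bipoly"
  assumes "\<And>m. m \<in> Poly_Mapping.keys p \<Longrightarrow> A \<and> 1 \<le> expo m i \<or> B \<and> 1 \<le> expo m j"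
  obtains f g where "p = X i * f + X j * g" "\<not> A \<longrightarrow> f = 0" "\<not> B \<longrightarrow> g = 0"
proof -
  have "\<exists>f g. p = X i * f + X j * g \<and> (\<not> A \<longrightarrow> f = 0) \<and> (\<not> B \<longrightarrow> g = 0)"
  proof (induction p rule: poly_mapping_monomial_induct)
    case (monomial m c)
    from assms[OF this] show ?case
    proof
      assume m: "A \<and> 1 \<le> expo m i"
      then obtain n where "Poly_Mapping.single m c = X i * Poly_Mapping.single n c"
        using monomial_factor by metis
      with m show ?thesis by (intro exI[of _ "Poly_Mapping.single n c"] exI[of _ 0]) simp
    next
      assume m: "B \<and> 1 \<le> expo m j"
      then obtain n where "Poly_Mapping.single m c = X j * Poly_Mapping.single n c"
        using monomial_factor by metis
      with m show ?thesis by (intro exI[of _ 0] exI[of _ "Poly_Mapping.single n c"]) simp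
    qed
  next
    case (add p p')
    then obtain f g f' g' where "p = X i * f + X j * g" "\<not> A \<longrightarrow> f = 0" "\<not> B \<longrightarrow> g = 0"
      "p' = X i * f' + X j * g'" "\<not> A \<longrightarrow> f' = 0" "\<not> B \<longrightarrow> g' = 0" by blast
    then show ?case
      by (intro exI[of _ "f + f'"] exI[of _ "g + g'"]) (simp add: algebra_simps)
  qed (auto intro!: exI[of _ 0])
  then show ?thesis using that by blast
qed

text \<open>Every monomial of \<open>X i * p\<close> is divisible by \<open>X j\<close>, hence so is
  every monomial of \<open>p\<close>, since the variables differ. Cancelling \<open>X j\<close> then
  determines \<open>q\<close>.\<close>

lemma koszul_relation:
  fixes p q :: "'k::field bipoly"
  assumes "X i * p + X j * q = 0" "i \<noteq> j"
  obtains k where "p = X j * k" "q = - (X i * k)"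
proof -
  have eq: "X i * p = X j * (- q)" using assms(1) by (simp add: add_eq_0_iff2)
  have "1 \<le> expo m j" if "m \<in> Poly_Mapping.keys p" for m
  proof -
    have "Poly_Mapping.single i 1 + m \<in> Poly_Mapping.keys (X i * p)"
      using that by (auto simp: keys_X_times)
    then obtain n where "Poly_Mapping.single i 1 + m = Poly_Mapping.single j 1 + n"
      unfolding eq keys_X_times by blast
    then have "expo (Poly_Mapping.single i 1 + m) j = expo (Poly_Mapping.single j 1 + n) j" by simp
    then show ?thesis using assms(2) by (simp add: lookup_add lookup_single when_def)
  qed
  \<comment> \<open>With the first flag false, the splitting is a division by
    \<open>X j\<close>.\<close>
  then obtain f k where "p = X i * f + X j * k" "f = 0"
    using split_by_variables[of p False i True j] by metis
  then have p: "p = X j * k" by simp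
  have "X j * (X i * k + q) = 0" using assms(1) by (simp add: p algebra_simps)
  then have "q = - (X i * k)" by (simp add: add_eq_0_iff)
  with p show ?thesis using that by blast
qed

section \<open>The complex of a staircase region\<close>

text \<open>Once x0 and x2 have exponents \<open>a \<le> q\<close> and \<open>c \<le> r\<close>, the
  two conditions for \<open>q\<close> and \<open>r\<close> force at least the exponents
  \<open>q - a\<close> of x3 and \<open>r - c\<close> of x1. The vertex monomials attain
  equality.\<close>

definition vertex_exponent :: "nat \<Rightarrow> nat \<Rightarrow> nat \<times> nat \<Rightarrow> (4 \<Rightarrow>\<^sub>0 nat)" where
  "vertex_exponent q r = (\<lambda>(a, c). Poly_Mapping.single 0 a + Poly_Mapping.single 1 (r - c) +
     Poly_Mapping.single 2 c + Poly_Mapping.single 3 (q - a))"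

definition vertex_monomial :: "nat \<Rightarrow> nat \<Rightarrow> nat \<times> nat \<Rightarrow> 'k::field bipoly" where
  "vertex_monomial q r z = Poly_Mapping.single (vertex_exponent q r z) 1"

lemma lookup_vertex_exponent:
  "expo (vertex_exponent q r (a, c)) 0 = a" "expo (vertex_exponent q r (a, c)) 1 = r - c"
  "expo (vertex_exponent q r (a, c)) 2 = c" "expo (vertex_exponent q r (a, c)) 3 = q - a"
  by (simp_all add: vertex_exponent_def lookup_add lookup_single when_def)

lemma vertex_monomial_horizontal:
  assumes "a < q"
  shows "X 0 * vertex_monomial q r (a, c) = X 3 * vertex_monomial q r (Suc a, c)"
proof -
  have "Poly_Mapping.single 0 1 + vertex_exponent q r (a, c) =
      Poly_Mapping.single 3 1 + vertex_exponent q r (Suc a, c)"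
    using assms by (intro exponents_eqI) (simp_all add: lookup_add lookup_single when_def lookup_vertex_exponent lookup_vertex_exponent(2)[unfolded One_nat_def])
  then show ?thesis by (simp add: X_def vertex_monomial_def mult_single)
qed

lemma vertex_monomial_vertical:
  assumes "c < r"
  shows "X 2 * vertex_monomial q r (a, c) = X 1 * vertex_monomial q r (a, Suc c)"
proof -
  have "Poly_Mapping.single 2 1 + vertex_exponent q r (a, c) =
      Poly_Mapping.single 1 1 + vertex_exponent q r (a, Suc c)"
    using assms by (intro exponents_eqI) (simp_all add: lookup_add lookup_single when_def lookup_vertex_exponent)
  then show ?thesis by (simp add: X_def vertex_monomial_def mult_single)
qed

text \<open>The value 0 on the border means that no edge enters the quadrant from outside. It also
  starts the inductions along rows and columns.\<close>

definition shift1 :: "(nat \<Rightarrow> nat \<Rightarrow> 'a::zero) \<Rightarrow> nat \<Rightarrow> nat \<Rightarrow> 'a" where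
  "shift1 f a c = (if a = 0 then 0 else f (a - 1) c)"

definition shift2 :: "(nat \<Rightarrow> nat \<Rightarrow> 'a::zero) \<Rightarrow> nat \<Rightarrow> nat \<Rightarrow> 'a" where
  "shift2 f a c = (if c = 0 then 0 else f a (c - 1))"

text \<open>A horizontal edge runs from \<open>(a, c)\<close> to \<open>(a + 1, c)\<close>, a vertical one from \<open>(a, c)\<close> to
  \<open>(a, c + 1)\<close>, and all edges and unit squares are indexed by their lower left corner.\<close>

definition edge_boundary :: "(nat \<Rightarrow> nat \<Rightarrow> 'k::field bipoly) \<Rightarrow> (nat \<Rightarrow> nat \<Rightarrow> 'k bipoly) \<Rightarrow> nat \<Rightarrow> nat \<Rightarrow> 'k bipoly" where
  "edge_boundary h v a c = X 0 * h a c - X 3 * shift1 h a c + X 2 * v a c - X 1 * shift2 v a c"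

definition square_boundary_h :: "(nat \<Rightarrow> nat \<Rightarrow> 'k::field bipoly) \<Rightarrow> nat \<Rightarrow> nat \<Rightarrow> 'k bipoly" where
  "square_boundary_h s a c = X 2 * s a c - X 1 * shift2 s a c"

definition square_boundary_v :: "(nat \<Rightarrow> nat \<Rightarrow> 'k::field bipoly) \<Rightarrow> nat \<Rightarrow> nat \<Rightarrow> 'k bipoly" where
  "square_boundary_v s a c = X 3 * shift1 s a c - X 0 * s a c"

text \<open>For the full grid this is the tensor product of two path complexes, one in x0 and x3,
  the other in x1 and x2. The opposite sign in \<open>square_boundary_v\<close> is the usual sign of
  a tensor product and makes the mixed terms cancel.\<close>

lemma edge_boundary_square_boundary:
  "edge_boundary (square_boundary_h s) (square_boundary_v s) a c = 0"
  by (simp add: edge_boundary_def square_boundary_h_def square_boundary_v_def shift1_def shift2_def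
      algebra_simps)

lemma edge_boundary_add:
  "edge_boundary (\<lambda>a c. h a c + h' a c) (\<lambda>a c. v a c + v' a c) a c =
     edge_boundary h v a c + edge_boundary h' v' a c"
  by (simp add: edge_boundary_def shift1_def shift2_def algebra_simps)

lemma square_boundary_add:
  "square_boundary_h (\<lambda>a c. s a c + s' a c) a c = square_boundary_h s a c + square_boundary_h s' a c"
  "square_boundary_v (\<lambda>a c. s a c + s' a c) a c = square_boundary_v s a c + square_boundary_v s' a c"
  by (simp_all add: square_boundary_h_def square_boundary_v_def shift1_def shift2_def algebra_simps)

text \<open>In row 0 only \<open>X 2 * s a 0\<close> remains, and each further row reduces to the
  previous one; \<open>X 2\<close> can be cancelled. The horizontal half of the boundary thus
  already gives injectivity at the squares.\<close>

lemma square_boundary_h_eq_0D: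
  assumes "\<And>a c. square_boundary_h s a c = 0"
  shows "s a c = 0"
proof (induction c)
  case 0
  show ?case using assms[of a 0] by (simp add: square_boundary_h_def shift2_def)
next
  case (Suc c)
  then show ?case
    using assms[of a "Suc c"] by (simp add: square_boundary_h_def shift2_def)
qed

section \<open>Staircases and their cells\<close>

definition staircase :: "nat \<Rightarrow> nat \<Rightarrow> (nat \<times> nat) set \<Rightarrow> bool" where
  "staircase q r Q \<longleftrightarrow> Q \<subseteq> {..q} \<times> {..r} \<and>
     (\<forall>a c a' c'. (a, c) \<in> Q \<longrightarrow> a \<le> a' \<longrightarrow> a' \<le> q \<longrightarrow> c \<le> c' \<longrightarrow> c' \<le> r \<longrightarrow> (a', c') \<in> Q)"

text \<open>Upward closure makes the lower left corner decide: if it lies in \<open>Q\<close> and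
  the bound leaves room, the whole edge lies in \<open>Q\<close>. The same holds for vertical edges
  and squares.\<close>

definition horizontal_edges :: "nat \<Rightarrow> (nat \<times> nat) set \<Rightarrow> (nat \<times> nat) set" where
  "horizontal_edges q Q = {(a, c) \<in> Q. a < q}"

definition vertical_edges :: "nat \<Rightarrow> (nat \<times> nat) set \<Rightarrow> (nat \<times> nat) set" where
  "vertical_edges r Q = {(a, c) \<in> Q. c < r}"

definition squares :: "nat \<Rightarrow> nat \<Rightarrow> (nat \<times> nat) set \<Rightarrow> (nat \<times> nat) set" where
  "squares q r Q = {(a, c) \<in> Q. a < q \<and> c < r}"

definition supported :: "(nat \<times> nat) set \<Rightarrow> (nat \<Rightarrow> nat \<Rightarrow> 'a::zero) \<Rightarrow> bool" where
  "supported S f \<longleftrightarrow> (\<forall>a c. (a, c) \<notin> S \<longrightarrow> f a c = 0)"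

lemma staircase_finite: "staircase q r Q \<Longrightarrow> finite Q"
  unfolding staircase_def by (meson finite_SigmaI finite_atMost finite_subset)

lemma staircase_up:
  "\<lbrakk>staircase q r Q; (a, c) \<in> Q; a \<le> a'; a' \<le> q; c \<le> c'; c' \<le> r\<rbrakk> \<Longrightarrow> (a', c') \<in> Q"
  unfolding staircase_def by blast

lemma staircase_bounds: "staircase q r Q \<Longrightarrow> (a, c) \<in> Q \<Longrightarrow> a \<le> q \<and> c \<le> r"
  unfolding staircase_def by auto

text \<open>A vertex with least coordinate sum dominates no other vertex, so its removal keeps
  upward closure. This is the induction step for exactness and the reason for working with arbitrary
  staircases: regions cut out by a bound on \<open>a + c\<close> are not stable under it.\<close>

lemma staircase_minimal:
  assumes "staircase q r Q" "Q \<noteq> {}"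
  obtains a c where "(a, c) \<in> Q" "staircase q r (Q - {(a, c)})"
    "\<And>a' c'. (a', c') \<in> Q \<Longrightarrow> (a', c') \<noteq> (a, c) \<Longrightarrow> a < a' \<or> c < c'"
proof -
  define z where "z = arg_min_on (\<lambda>(a, c). a + c) Q"
  have z: "z \<in> Q" "\<And>y. y \<in> Q \<Longrightarrow> (\<lambda>(a, c). a + c) z \<le> (\<lambda>(a, c). a + c) y"
    unfolding z_def
    using arg_min_if_finite(1)[OF staircase_finite[OF assms(1)] assms(2)]
      arg_min_least[OF staircase_finite[OF assms(1)] assms(2)] by blast+
  obtain a c where ac: "z = (a, c)" by fastforce
  have min: "a < a' \<or> c < c'" if "(a', c') \<in> Q" "(a', c') \<noteq> (a, c)" for a' c'
    using z(2)[OF that(1)] that(2) by (auto simp: ac)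
  moreover have "staircase q r (Q - {(a, c)})"
    unfolding staircase_def
  proof (intro conjI allI impI)
    fix a1 c1 a' c' assume "(a1, c1) \<in> Q - {(a, c)}" "a1 \<le> a'" "a' \<le> q" "c1 \<le> c'" "c' \<le> r"
    then show "(a', c') \<in> Q - {(a, c)}"
      using staircase_up[OF assms(1), of a1 c1 a' c'] min[of a1 c1] by auto
  qed (use assms(1) in \<open>auto simp: staircase_def\<close>)
  ultimately show ?thesis using that z(1) ac by blast
qed

text \<open>The contributions of an edge at its two ends cancel because both multiply to the same
  monomial, the least common multiple of the two vertex monomials.\<close>

lemma sum_edge_boundary:
  assumes Q: "staircase q r Q"
    and h: "supported (horizontal_edges q Q) h" and v: "supported (vertical_edges r Q) v"
  shows "(\<Sum>(a, c)\<in>Q. edge_boundary h v a c * vertex_monomial q r (a, c)) = 0"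
proof -
  let ?M = "vertex_monomial q r"
  note fin = staircase_finite[OF Q]
  \<comment> \<open>The sum over left ends is reindexed by right ends. The exceptional sets consist
    of the vertices that no horizontal edge leaves, respectively enters; all their terms
    vanish.\<close>
  have H: "(\<Sum>(a, c)\<in>Q. X 0 * h a c * ?M (a, c)) = (\<Sum>(a, c)\<in>Q. X 3 * shift1 h a c * ?M (a, c))"
  proof (rule sum.reindex_bij_witness_not_neutral
      [where i = "\<lambda>(a, c). (a - 1, c)" and j = "\<lambda>(a, c). (Suc a, c)"
        and S' = "Q - horizontal_edges q Q" and T' = "{(a, c) \<in> Q. a = 0 \<or> (a - 1, c) \<notin> Q}"])
    fix z assume "z \<in> Q - (Q - horizontal_edges q Q)"
    then obtain a c where z: "z = (a, c)" "(a, c) \<in> Q" "a < q"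
      by (auto simp: horizontal_edges_def)
    show "(case z of (a, c) \<Rightarrow> (Suc a, c)) \<in> Q - {(a, c) \<in> Q. a = 0 \<or> (a - 1, c) \<notin> Q}"
      using z staircase_up[OF Q z(2), of "Suc a" c] staircase_bounds[OF Q z(2)] by auto
  next
    fix z assume "z \<in> Q - {(a, c) \<in> Q. a = 0 \<or> (a - 1, c) \<notin> Q}"
    then obtain a c where "z = (Suc a, c)" "(Suc a, c) \<in> Q" "(a, c) \<in> Q"
      by (cases z; cases "fst z") auto
    then show "(case z of (a, c) \<Rightarrow> (a - 1, c)) \<in> Q - (Q - horizontal_edges q Q)"
      using staircase_bounds[OF Q, of "Suc a" c] by (auto simp: horizontal_edges_def)
  next
    fix z assume "z \<in> Q"
    show "(case (case z of (a, c) \<Rightarrow> (Suc a, c)) of (a, c) \<Rightarrow> X 3 * shift1 h a c * ?M (a, c)) =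
        (case z of (a, c) \<Rightarrow> X 0 * h a c * ?M (a, c))"
    proof (cases z)
      case (Pair a c)
      show ?thesis
      proof (cases "a < q")
        case True
        then show ?thesis by (simp add: Pair shift1_def vertex_monomial_horizontal)
      next
        case False
        then have "h a c = 0" using h by (auto simp: supported_def horizontal_edges_def)
        then show ?thesis by (simp add: Pair shift1_def)
      qed
    qed
  next
    show "finite {(a, c) \<in> Q. a = 0 \<or> (a - 1, c) \<notin> Q}"
      by (rule finite_subset[OF _ fin]) auto
  next
    fix z assume "z \<in> Q - horizontal_edges q Q"
    then show "(case z of (a, c) \<Rightarrow> X 0 * h a c * ?M (a, c)) = 0"
      using h by (cases z) (simp add: supported_def)
  qed (use h fin in \<open>auto simp: supported_def shift1_def horizontal_edges_def\<close>)
  have V: "(\<Sum>(a, c)\<in>Q. X 2 * v a c * ?M (a, c)) = (\<Sum>(a, c)\<in>Q. X 1 * shift2 v a c * ?M (a, c))"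
  proof (rule sum.reindex_bij_witness_not_neutral
      [where i = "\<lambda>(a, c). (a, c - 1)" and j = "\<lambda>(a, c). (a, Suc c)"
        and S' = "Q - vertical_edges r Q" and T' = "{(a, c) \<in> Q. c = 0 \<or> (a, c - 1) \<notin> Q}"])
    fix z assume "z \<in> Q - (Q - vertical_edges r Q)"
    then obtain a c where z: "z = (a, c)" "(a, c) \<in> Q" "c < r"
      by (auto simp: vertical_edges_def)
    show "(case z of (a, c) \<Rightarrow> (a, Suc c)) \<in> Q - {(a, c) \<in> Q. c = 0 \<or> (a, c - 1) \<notin> Q}"
      using z staircase_up[OF Q z(2), of a "Suc c"] staircase_bounds[OF Q z(2)] by auto
  next
    fix z assume "z \<in> Q - {(a, c) \<in> Q. c = 0 \<or> (a, c - 1) \<notin> Q}"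
    then obtain a c where "z = (a, Suc c)" "(a, Suc c) \<in> Q" "(a, c) \<in> Q"
      by (cases z; cases "snd z") auto
    then show "(case z of (a, c) \<Rightarrow> (a, c - 1)) \<in> Q - (Q - vertical_edges r Q)"
      using staircase_bounds[OF Q, of a "Suc c"] by (auto simp: vertical_edges_def)
  next
    fix z assume "z \<in> Q"
    show "(case (case z of (a, c) \<Rightarrow> (a, Suc c)) of (a, c) \<Rightarrow> X 1 * shift2 v a c * ?M (a, c)) =
        (case z of (a, c) \<Rightarrow> X 2 * v a c * ?M (a, c))"
    proof (cases z)
      case (Pair a c)
      show ?thesis
      proof (cases "c < r")
        case True
        then show ?thesis by (simp add: Pair shift2_def vertex_monomial_vertical)
      next
        case False
        then have "v a c = 0" using v by (auto simp: supported_def vertical_edges_def)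
        then show ?thesis by (simp add: Pair shift2_def)
      qed
    qed
  next
    show "finite {(a, c) \<in> Q. c = 0 \<or> (a, c - 1) \<notin> Q}"
      by (rule finite_subset[OF _ fin]) auto
  next
    fix z assume "z \<in> Q - vertical_edges r Q"
    then show "(case z of (a, c) \<Rightarrow> X 2 * v a c * ?M (a, c)) = 0"
      using v by (cases z) (simp add: supported_def)
  qed (use v fin in \<open>auto simp: supported_def shift2_def vertical_edges_def\<close>)
  have "(\<Sum>(a, c)\<in>Q. edge_boundary h v a c * ?M (a, c)) =
      (\<Sum>(a, c)\<in>Q. X 0 * h a c * ?M (a, c)) - (\<Sum>(a, c)\<in>Q. X 3 * shift1 h a c * ?M (a, c)) +
      ((\<Sum>(a, c)\<in>Q. X 2 * v a c * ?M (a, c)) - (\<Sum>(a, c)\<in>Q. X 1 * shift2 v a c * ?M (a, c)))"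
    unfolding sum_subtractf[symmetric] sum.distrib[symmetric]
    by (intro sum.cong) (auto simp: edge_boundary_def algebra_simps)
  then show ?thesis by (simp add: H V)
qed

lemma supported_add: "supported S f \<Longrightarrow> supported S g \<Longrightarrow> supported S (\<lambda>a c. f a c + g a c :: 'a::monoid_add)"
  by (simp add: supported_def)

lemma supported_mono: "supported S f \<Longrightarrow> S \<subseteq> T \<Longrightarrow> supported T f"
  by (auto simp: supported_def)

definition point_mass :: "nat \<Rightarrow> nat \<Rightarrow> 'a::zero \<Rightarrow> nat \<Rightarrow> nat \<Rightarrow> 'a" where
  "point_mass a0 c0 x a c = (if a = a0 \<and> c = c0 then x else 0)"

lemma supported_point_mass:
  "((a0, c0) \<notin> S \<Longrightarrow> x = 0) \<Longrightarrow> supported S (point_mass a0 c0 x)"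
  by (auto simp: supported_def point_mass_def)

lemma point_mass_eq: "point_mass a0 c0 x a0 c0 = x"
  by (simp add: point_mass_def)

lemma shift_point_mass:
  "shift1 (point_mass a0 c0 x) a0 c = 0" "shift2 (point_mass a0 c0 x) a c0 = 0"
  by (auto simp: shift1_def shift2_def point_mass_def)

text \<open>An edge entering a minimal vertex would start at a vertex of \<open>Q\<close> that is
  dominated by it.\<close>

lemma shift_eq_0:
  assumes "supported (horizontal_edges q Q) h" "supported (vertical_edges r Q) v"
    and min: "\<And>a c. (a, c) \<in> Q \<Longrightarrow> (a, c) \<noteq> (a0, c0) \<Longrightarrow> a0 < a \<or> c0 < c"
  shows "shift1 h a0 c0 = 0" "shift2 v a0 c0 = 0"
proof -
  have "(a0 - 1, c0) \<notin> Q" if "a0 \<noteq> 0" using min[of "a0 - 1" c0] that by force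
  then show "shift1 h a0 c0 = 0"
    using assms(1) by (simp add: shift1_def supported_def horizontal_edges_def)
  have "(a0, c0 - 1) \<notin> Q" if "c0 \<noteq> 0" using min[of a0 "c0 - 1"] that by force
  then show "shift2 v a0 c0 = 0"
    using assms(2) by (simp add: shift2_def supported_def vertical_edges_def)
qed

text \<open>Both exactness statements are proved by removing a minimal vertex \<open>(a, c)\<close>. The
  monomials of all other vertices are divisible by \<open>x\<^sub>0\<^sup>a\<^sup>+\<^sup>1\<close> or by \<open>x\<^sub>2\<^sup>c\<^sup>+\<^sup>1\<close>, so a
  coefficient at \<open>(a, c)\<close> in a relation lies in \<open>(x\<^sub>0, x\<^sub>2)\<close> and can be removed by
  the edges leaving \<open>(a, c)\<close>.\<close>

lemma exact_at_vertices:
  fixes f :: "nat \<Rightarrow> nat \<Rightarrow> 'k::field bipoly"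
  assumes "staircase q r Q"
    and "(\<Sum>(a, c)\<in>Q. f a c * vertex_monomial q r (a, c)) = 0"
  shows "\<exists>h v. supported (horizontal_edges q Q) h \<and> supported (vertical_edges r Q) v \<and>
    (\<forall>(a, c)\<in>Q. f a c = edge_boundary h v a c)"
  using assms
proof (induction "card Q" arbitrary: Q f)
  case 0
  then have "Q = {}" using staircase_finite by auto
  then show ?case by (intro exI[of _ "\<lambda>_ _. 0"]) (simp add: supported_def)
next
  case (Suc n)
  note Q = \<open>staircase q r Q\<close>
  note fin = staircase_finite[OF Q]
  have "Q \<noteq> {}" using Suc.hyps(2) by auto
  from staircase_minimal[OF Q this] obtain a0 c0 where z: "(a0, c0) \<in> Q"
    and Q': "staircase q r (Q - {(a0, c0)})"
    and min: "\<And>a c. (a, c) \<in> Q \<Longrightarrow> (a, c) \<noteq> (a0, c0) \<Longrightarrow> a0 < a \<or> c0 < c" by metis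
  let ?Q = "Q - {(a0, c0)}" and ?M = "vertex_monomial q r :: _ \<Rightarrow> 'k bipoly"
  have sum: "f a0 c0 * ?M (a0, c0) = - (\<Sum>(a, c)\<in>?Q. f a c * ?M (a, c))"
    using Suc.prems(2) by (simp add: sum.remove[OF fin z] add_eq_0_iff2)
  have "a0 < q \<and> 1 \<le> expo m 0 \<or> c0 < r \<and> 1 \<le> expo m 2" if m: "m \<in> Poly_Mapping.keys (f a0 c0)" for m
  proof -
    let ?e = "vertex_exponent q r"
    have "?e (a0, c0) + m \<in> Poly_Mapping.keys (f a0 c0 * ?M (a0, c0))"
      using m by (simp add: vertex_monomial_def mult.commute[of "f a0 c0"] keys_single_times)
    then have "?e (a0, c0) + m \<in> Poly_Mapping.keys (\<Sum>(a, c)\<in>?Q. f a c * ?M (a, c))"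
      unfolding sum keys_minus .
    then obtain y where y: "y \<in> ?Q" "?e (a0, c0) + m \<in> Poly_Mapping.keys (case y of (a, c) \<Rightarrow> f a c * ?M (a, c))"
      using keys_sum[of "\<lambda>(a, c). f a c * ?M (a, c)" ?Q] by blast
    obtain a c where "y = (a, c)" by fastforce
    with y have ac: "(a, c) \<in> ?Q" "?e (a0, c0) + m \<in> Poly_Mapping.keys (f a c * ?M (a, c))"
      by simp_all
    from ac(2) obtain n where "?e (a0, c0) + m = ?e (a, c) + n"
      by (auto simp: vertex_monomial_def mult.commute[of "f a c"] keys_single_times)
    then have "expo (?e (a0, c0) + m) i = expo (?e (a, c) + n) i" for i by simp
    \<comment> \<open>If \<open>a0 < a\<close>, then x0 divides the monomial \<open>m\<close>, and
      \<open>a \<le> q\<close> shows that the horizontal edge at \<open>(a0, c0)\<close> exists. The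
      case \<open>c0 < c\<close> is symmetric, so divisibility and existence of the edge come
      together.\<close>
    from this[of 0] this[of 2] have "a0 + expo m 0 = a + expo n 0" "c0 + expo m 2 = c + expo n 2"
      by (simp_all add: lookup_add lookup_vertex_exponent)
    moreover have "a0 < a \<or> c0 < c" using ac(1) min by blast
    moreover have "a \<le> q" "c \<le> r" using staircase_bounds[OF Q] ac(1) by auto
    ultimately show ?thesis by linarith
  qed
  then obtain \<alpha> \<beta> where \<alpha>\<beta>: "f a0 c0 = X 0 * \<alpha> + X 2 * \<beta>" "\<not> a0 < q \<longrightarrow> \<alpha> = 0" "\<not> c0 < r \<longrightarrow> \<beta> = 0"
    by (rule split_by_variables) blast
  let ?h = "point_mass a0 c0 \<alpha>" and ?v = "point_mass a0 c0 \<beta>"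
  have h: "supported (horizontal_edges q Q) ?h" and v: "supported (vertical_edges r Q) ?v"
    using z \<alpha>\<beta> by (auto intro!: supported_point_mass simp: horizontal_edges_def vertical_edges_def)
  \<comment> \<open>Subtracting the boundary of the two edges clears the coefficient at the minimal
    vertex, which leaves a relation on the smaller staircase.\<close>
  define f' where "f' = (\<lambda>a c. f a c - edge_boundary ?h ?v a c)"
  have f'0: "f' a0 c0 = 0"
    by (simp add: f'_def \<alpha>\<beta>(1) edge_boundary_def shift_point_mass point_mass_eq)
  have "(\<Sum>(a, c)\<in>Q. f' a c * ?M (a, c)) =
      (\<Sum>(a, c)\<in>Q. f a c * ?M (a, c)) - (\<Sum>(a, c)\<in>Q. edge_boundary ?h ?v a c * ?M (a, c))"
    unfolding sum_subtractf[symmetric] by (intro sum.cong) (auto simp: f'_def algebra_simps)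
  also have "\<dots> = 0" using sum_edge_boundary[OF Q h v] Suc.prems(2) by simp
  finally have "(\<Sum>(a, c)\<in>?Q. f' a c * ?M (a, c)) = 0"
    by (simp add: sum.remove[OF fin z] f'0)
  moreover have "n = card ?Q" using Suc.hyps(2) z fin by simp
  ultimately obtain h' v' where h': "supported (horizontal_edges q ?Q) h'"
    and v': "supported (vertical_edges r ?Q) v'"
    and f': "\<forall>(a, c)\<in>?Q. f' a c = edge_boundary h' v' a c"
    using Suc.hyps(1)[OF _ Q'] by blast
  \<comment> \<open>The edges supplied by induction avoid the removed vertex: none starts there, and
    by minimality none ends there. So the clearing at that vertex is not undone.\<close>
  have "edge_boundary h' v' a0 c0 = 0"
  proof -
    have "h' a0 c0 = 0" "v' a0 c0 = 0"
      using h' v' by (auto simp: supported_def horizontal_edges_def vertical_edges_def)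
    moreover have "shift1 h' a0 c0 = 0" "shift2 v' a0 c0 = 0"
      using shift_eq_0[OF supported_mono[OF h', of "horizontal_edges q Q"]
          supported_mono[OF v', of "vertical_edges r Q"], of a0 c0] min
      by (auto simp: horizontal_edges_def vertical_edges_def)
    ultimately show ?thesis by (simp add: edge_boundary_def)
  qed
  then have "f' a c = edge_boundary h' v' a c" if "(a, c) \<in> Q" for a c
    using that f' f'0 by (cases "(a, c) = (a0, c0)") auto
  then have "\<forall>(a, c)\<in>Q. f a c = edge_boundary (\<lambda>a c. h' a c + ?h a c) (\<lambda>a c. v' a c + ?v a c) a c"
    unfolding edge_boundary_add by (force simp: f'_def algebra_simps)
  moreover have "supported (horizontal_edges q Q) (\<lambda>a c. h' a c + ?h a c)"
    by (intro supported_add h supported_mono[OF h']) (auto simp: horizontal_edges_def)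
  moreover have "supported (vertical_edges r Q) (\<lambda>a c. v' a c + ?v a c)"
    by (intro supported_add v supported_mono[OF v']) (auto simp: vertical_edges_def)
  ultimately show ?case by blast
qed

lemma exact_at_edges:
  fixes h v :: "nat \<Rightarrow> nat \<Rightarrow> 'k::field bipoly"
  assumes "staircase q r Q"
    and "supported (horizontal_edges q Q) h" "supported (vertical_edges r Q) v"
    and "\<forall>(a, c)\<in>Q. edge_boundary h v a c = 0"
  shows "\<exists>s. supported (squares q r Q) s \<and>
    (\<forall>a c. h a c = square_boundary_h s a c) \<and> (\<forall>a c. v a c = square_boundary_v s a c)"
  using assms
proof (induction "card Q" arbitrary: Q h v)
  case 0
  then have "Q = {}" using staircase_finite by auto
  then show ?case using 0
    by (intro exI[of _ "\<lambda>_ _. 0"])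
      (simp add: supported_def square_boundary_h_def square_boundary_v_def shift1_def shift2_def
        horizontal_edges_def vertical_edges_def)
next
  case (Suc n)
  note Q = \<open>staircase q r Q\<close>
  note fin = staircase_finite[OF Q] and h = Suc.prems(2) and v = Suc.prems(3)
  have "Q \<noteq> {}" using Suc.hyps(2) by auto
  from staircase_minimal[OF Q this] obtain a0 c0 where z: "(a0, c0) \<in> Q"
    and Q': "staircase q r (Q - {(a0, c0)})"
    and min: "\<And>a c. (a, c) \<in> Q \<Longrightarrow> (a, c) \<noteq> (a0, c0) \<Longrightarrow> a0 < a \<or> c0 < c" by metis
  let ?Q = "Q - {(a0, c0)}"
  \<comment> \<open>Nothing enters a minimal vertex, so the relation at it involves only the two
    outgoing edges. It is a Koszul relation between x0 and x2, and its multiplier \<open>k\<close>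
    is the value to be given to the square at this corner.\<close>
  have "shift1 h a0 c0 = 0" "shift2 v a0 c0 = 0"
    by (rule shift_eq_0[OF h v]; use min in blast)+
  moreover have "edge_boundary h v a0 c0 = 0" using Suc.prems(4) z by blast
  ultimately have "X 0 * h a0 c0 + X 2 * v a0 c0 = 0" by (simp add: edge_boundary_def)
  then obtain k where k: "h a0 c0 = X 2 * k" "v a0 c0 = - (X 0 * k)"
    by (rule koszul_relation) auto
  have "h a0 c0 = 0" if "\<not> a0 < q"
    using h that by (auto simp: supported_def horizontal_edges_def)
  moreover have "v a0 c0 = 0" if "\<not> c0 < r"
    using v that by (auto simp: supported_def vertical_edges_def)
  \<comment> \<open>If one of the two edges is missing, its coefficient is 0 and the multiplier
    vanishes. A nonzero \<open>k\<close> therefore occurs only where the square exists.\<close>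
  ultimately have k0: "k = 0" if "\<not> (a0 < q \<and> c0 < r)"
    using that k by fastforce
  \<comment> \<open>These are the four sides of the square, all present by upward closure. Hence
    subtracting its boundary does not enlarge the supports.\<close>
  have up: "(a0, c0) \<in> horizontal_edges q Q" "(a0, Suc c0) \<in> horizontal_edges q Q"
    "(a0, c0) \<in> vertical_edges r Q" "(Suc a0, c0) \<in> vertical_edges r Q" if "k \<noteq> 0"
    using k0 that z staircase_up[OF Q z, of a0 "Suc c0"] staircase_up[OF Q z, of "Suc a0" c0]
    by (force simp: horizontal_edges_def vertical_edges_def)+
  let ?s = "point_mass a0 c0 k"
  have s: "supported (squares q r Q) ?s"
    using k0 z by (auto intro!: supported_point_mass simp: squares_def)
  define h' where "h' = (\<lambda>a c. h a c - square_boundary_h ?s a c)"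
  define v' where "v' = (\<lambda>a c. v a c - square_boundary_v ?s a c)"
  have "h' a0 c0 = 0" "v' a0 c0 = 0"
    by (simp_all add: h'_def v'_def k square_boundary_h_def square_boundary_v_def
        shift_point_mass point_mass_eq)
  moreover have "h' a c = 0" if "(a, c) \<notin> horizontal_edges q Q" for a c
  proof -
    have "?s a c = 0" "shift2 ?s a c = 0"
      using that up by (cases c; force simp: point_mass_def shift2_def)+
    then show ?thesis using h that by (simp add: h'_def square_boundary_h_def supported_def)
  qed
  moreover have "v' a c = 0" if "(a, c) \<notin> vertical_edges r Q" for a c
  proof -
    have "?s a c = 0" "shift1 ?s a c = 0"
      using that up by (cases a; force simp: point_mass_def shift1_def)+
    then show ?thesis using v that by (simp add: v'_def square_boundary_v_def supported_def)
  qed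
  ultimately have h': "supported (horizontal_edges q ?Q) h'" and v': "supported (vertical_edges r ?Q) v'"
    by (auto simp: supported_def horizontal_edges_def vertical_edges_def)
  have eq: "h a c = h' a c + square_boundary_h ?s a c" "v a c = v' a c + square_boundary_v ?s a c" for a c
    by (simp_all add: h'_def v'_def)
  have "edge_boundary h v a c = edge_boundary (\<lambda>a c. h' a c + square_boundary_h ?s a c)
      (\<lambda>a c. v' a c + square_boundary_v ?s a c) a c" for a c
    by (simp add: h'_def v'_def)
  then have "edge_boundary h v a c = edge_boundary h' v' a c" for a c
    unfolding edge_boundary_add edge_boundary_square_boundary by simp
  then have "\<forall>(a, c)\<in>?Q. edge_boundary h' v' a c = 0" using Suc.prems(4) by auto
  moreover have "n = card ?Q" using Suc.hyps(2) z fin by simp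
  ultimately obtain s' where s': "supported (squares q r ?Q) s'"
    "\<And>a c. h' a c = square_boundary_h s' a c" "\<And>a c. v' a c = square_boundary_v s' a c"
    using Suc.hyps(1)[OF _ Q' h' v'] by blast
  have "supported (squares q r Q) (\<lambda>a c. s' a c + ?s a c)"
    by (intro supported_add s supported_mono[OF s'(1)]) (auto simp: squares_def)
  moreover have "h a c = square_boundary_h (\<lambda>a c. s' a c + ?s a c) a c"
    "v a c = square_boundary_v (\<lambda>a c. s' a c + ?s a c) a c" for a c
    unfolding square_boundary_add eq s'(2,3) by (rule refl)+
  ultimately show ?case by blast
qed

section \<open>Vectors and matrices indexed by cells\<close>

lemma vec_as_function:
  assumes "distinct xs" "w \<in> carrier_vec (length xs)"
  obtains F where "\<forall>x. x \<notin> set xs \<longrightarrow> F x = (0 :: 'a::zero)" "w = vec (length xs) (\<lambda>j. F (xs ! j))"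
proof
  \<comment> \<open>Extending by 0 outside the list supplies the support conditions under which the
    exactness lemmas are stated.\<close>
  let ?F = "\<lambda>x. if x \<in> set xs then w $ (THE j. j < length xs \<and> xs ! j = x) else 0"
  have "(THE i. i < length xs \<and> xs ! i = xs ! j) = j" if "j < length xs" for j
    using that assms(1) by (intro the_equality) (auto simp: nth_eq_iff_index_eq)
  then show "w = vec (length xs) (\<lambda>j. ?F (xs ! j))"
    using assms(2) by (intro eq_vecI) auto
qed simp

lemma sum_nth_distinct:
  "distinct xs \<Longrightarrow> (\<Sum>j<length xs. f (xs ! j)) = sum f (set xs)"
  by (simp add: sum.distinct_set_conv_list sum_list_sum_nth atLeast0LessThan)

lemma scalar_prod_functions:
  "distinct xs \<Longrightarrow> vec (length xs) (\<lambda>j. G (xs ! j)) \<bullet> vec (length xs) (\<lambda>j. F (xs ! j)) =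
     (\<Sum>x\<in>set xs. G x * F x)"
  by (simp add: scalar_prod_def sum_nth_distinct[symmetric] atLeast0LessThan)

lemma mat_vec_functions:
  assumes "distinct cs"
  shows "mat (length rs) (length cs) (\<lambda>(i, j). K (rs ! i) (cs ! j)) *\<^sub>v vec (length cs) (\<lambda>j. F (cs ! j)) =
    vec (length rs) (\<lambda>i. \<Sum>x\<in>set cs. K (rs ! i) x * F x)"
  using assms by (intro eq_vecI) (simp_all add: scalar_prod_functions)

lemma vec_functions_eq_iff:
  "vec (length xs) (\<lambda>j. F (xs ! j)) = vec (length xs) (\<lambda>j. G (xs ! j)) \<longleftrightarrow> (\<forall>x\<in>set xs. F x = G x)"
  by (simp add: vec_eq_iff all_set_conv_all_nth)

lemma vec_function_eq_0_iff:
  "vec (length xs) (\<lambda>j. F (xs ! j)) = 0\<^sub>v (length xs) \<longleftrightarrow> (\<forall>x\<in>set xs. F x = 0)"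
  by (simp add: vec_eq_iff all_set_conv_all_nth)

lemma zero_columns_mult_vec:
  "w \<in> carrier_vec 0 \<Longrightarrow> 0\<^sub>m k 0 *\<^sub>v w = (0\<^sub>v k :: 'a::semiring_0 vec)"
  by (intro eq_vecI) (auto simp: scalar_prod_def)

lemma image_zero_columns: "{0\<^sub>m k 0 *\<^sub>v w | w. w \<in> carrier_vec 0} = {0\<^sub>v k :: 'a::semiring_0 vec}"
proof -
  have "0\<^sub>v k = 0\<^sub>m k 0 *\<^sub>v (0\<^sub>v 0 :: 'a vec)" by (simp add: zero_columns_mult_vec)
  then show ?thesis using zero_columns_mult_vec[where 'a = 'a] zero_carrier_vec[of 0] by fast
qed

lemma kernel_zero_columns:
  "{v \<in> carrier_vec 0. 0\<^sub>m k 0 *\<^sub>v v = (0\<^sub>v k :: 'a::semiring_0 vec)} = {0\<^sub>v 0}"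
  by (auto simp: zero_columns_mult_vec)

text \<open>An edge is a pair of a flag (\<open>True\<close> for horizontal) and its lower left vertex.\<close>

definition edges :: "nat \<Rightarrow> nat \<Rightarrow> (nat \<times> nat) set \<Rightarrow> (bool \<times> nat \<times> nat) set" where
  "edges q r Q = Pair True ` horizontal_edges q Q \<union> Pair False ` vertical_edges r Q"

text \<open>The guards are needed because subtraction truncates: for \<open>a = 0\<close> the term
  \<open>a - 1\<close> would count the outgoing edge as an incoming one as well.\<close>

fun edge_coeff :: "nat \<times> nat \<Rightarrow> bool \<times> nat \<times> nat \<Rightarrow> 'k::field bipoly" where
  "edge_coeff (a, c) e =
     (if e = (True, a, c) then X 0 else 0) - (if 0 < a \<and> e = (True, a - 1, c) then X 3 else 0) +
     (if e = (False, a, c) then X 2 else 0) - (if 0 < c \<and> e = (False, a, c - 1) then X 1 else 0)"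

fun square_coeff :: "bool \<times> nat \<times> nat \<Rightarrow> nat \<times> nat \<Rightarrow> 'k::field bipoly" where
  "square_coeff (True, a, c) s =
     (if s = (a, c) then X 2 else 0) - (if 0 < c \<and> s = (a, c - 1) then X 1 else 0)"
| "square_coeff (False, a, c) s =
     (if 0 < a \<and> s = (a - 1, c) then X 3 else 0) - (if s = (a, c) then X 0 else 0)"

lemma sum_delta_times:
  fixes F :: "'a \<Rightarrow> 'b::ring"
  assumes "finite S" "\<forall>x. x \<notin> S \<longrightarrow> F x = 0"
  shows "(\<Sum>x\<in>S. (if P \<and> x = x0 then y else 0) * F x) = (if P then y * F x0 else 0)"
    "(\<Sum>x\<in>S. (if x = x0 then y else 0) * F x) = y * F x0"
  using assms by (auto simp: if_distrib[of "\<lambda>y. y * _"] sum.delta cong: if_cong)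

lemma sum_edge_coeff:
  assumes "finite S" "\<forall>e. e \<notin> S \<longrightarrow> F e = 0"
  shows "(\<Sum>e\<in>S. edge_coeff (a, c) e * F e) =
    edge_boundary (\<lambda>a c. F (True, a, c)) (\<lambda>a c. F (False, a, c)) a c"
  by (simp only: edge_coeff.simps left_diff_distrib distrib_right sum.distrib sum_subtractf
      sum_delta_times[where F = F, OF assms])
    (simp add: edge_boundary_def shift1_def shift2_def)

lemma sum_square_coeff:
  assumes "finite S" "\<forall>s. s \<notin> S \<longrightarrow> F s = 0"
  shows "(\<Sum>s\<in>S. square_coeff (True, a, c) s * F s) = square_boundary_h (\<lambda>a c. F (a, c)) a c"
    "(\<Sum>s\<in>S. square_coeff (False, a, c) s * F s) = square_boundary_v (\<lambda>a c. F (a, c)) a c"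
  by (simp_all only: square_coeff.simps left_diff_distrib sum_subtractf
      sum_delta_times[where F = F, OF assms])
    (simp_all add: square_boundary_h_def square_boundary_v_def shift1_def shift2_def)

fun vertex_degree :: "nat \<Rightarrow> nat \<Rightarrow> nat \<times> nat \<Rightarrow> int \<times> int" where
  "vertex_degree q r (a, c) = (int a + int r - int c, int c + int q - int a)"

fun edge_degree :: "nat \<Rightarrow> nat \<Rightarrow> bool \<times> nat \<times> nat \<Rightarrow> int \<times> int" where
  "edge_degree q r (b, z) = vertex_degree q r z + (if b then (1, 0) else (0, 1))"

definition square_degree :: "nat \<Rightarrow> nat \<Rightarrow> nat \<times> nat \<Rightarrow> int \<times> int" where
  "square_degree q r z = vertex_degree q r z + (1, 1)"

lemma bihomogeneous_X:
  "bihomogeneous (1, 0) (X 0)" "bihomogeneous (1, 0) (X 1)"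
  "bihomogeneous (0, 1) (X 2)" "bihomogeneous (0, 1) (X 3)"
  by (auto simp: bihomogeneous_def X_def bidegree_single)

lemma bihomogeneous_vertex_monomial:
  assumes "a \<le> q" "c \<le> r"
  shows "bihomogeneous (vertex_degree q r (a, c)) (vertex_monomial q r (a, c))"
  using assms
  by (auto simp: bihomogeneous_def vertex_monomial_def bidegree_def lookup_vertex_exponent
      lookup_vertex_exponent(2)[unfolded One_nat_def])

lemma bihomogeneous_edge_coeff:
  "bihomogeneous (edge_degree q r e - vertex_degree q r z) (edge_coeff z e)"
proof -
  obtain a c b a' c' where [simp]: "z = (a, c)" "e = (b, a', c')" by (metis surj_pair)
  show ?thesis
    by (cases b) (auto simp: bihomogeneous_X bihomogeneous_uminus)
qed

lemma bihomogeneous_square_coeff: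
  "bihomogeneous (square_degree q r s - edge_degree q r e) (square_coeff e s)"
proof -
  obtain a c b a' c' where [simp]: "s = (a', c')" "e = (b, a, c)" by (metis surj_pair)
  show ?thesis
    by (cases b) (auto simp: square_degree_def bihomogeneous_X bihomogeneous_uminus)
qed

lemma generated_ideal_diff:
  "x \<in> generated_ideal S \<Longrightarrow> y \<in> generated_ideal S \<Longrightarrow> x - y \<in> generated_ideal S"
  using generated_ideal_add[of x S "- y"] generated_ideal_uminus[of y S] by simp

lemma coeffs_in_irrelevant_ideal:
  "edge_coeff z e \<in> generated_ideal (range X)" "square_coeff e s \<in> generated_ideal (range X)"
proof -
  have X: "X i \<in> generated_ideal (range X)" for i :: 4
    by (rule generated_ideal_base) simp
  have if_X: "(if P then X i else 0) \<in> generated_ideal (range X)" for P and i :: 4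
    by (cases P) (simp_all only: if_True if_False X generated_ideal_0)
  show "edge_coeff z e \<in> generated_ideal (range X)"
    by (cases z) (simp only: edge_coeff.simps generated_ideal_add generated_ideal_diff if_X)
  show "square_coeff e s \<in> generated_ideal (range X)"
    by (cases e; cases "fst e")
      (simp_all only: fst_conv square_coeff.simps generated_ideal_diff if_X)
qed

text \<open>By upward closure the sides of a square in \<open>Q\<close> are edges in
  \<open>Q\<close>. This bridges the matrices, which know only the listed edges, and the boundary
  maps on functions, which are defined on the whole grid.\<close>

lemma square_boundary_h_eq_0_outside:
  assumes "staircase q r Q" "supported (squares q r Q) s" "(a, c) \<notin> horizontal_edges q Q"
  shows "square_boundary_h s a c = 0"
proof -
  have "s a c = 0" using assms(2,3) by (auto simp: supported_def squares_def horizontal_edges_def)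
  moreover have "s a (c - 1) = 0" if "c \<noteq> 0"
  proof (rule ccontr)
    assume "s a (c - 1) \<noteq> 0"
    then have "(a, c - 1) \<in> Q" "a < q" "c - 1 < r"
      using assms(2) by (auto simp: supported_def squares_def)
    then show False
      using staircase_up[OF assms(1), of a "c - 1" a c] assms(3) by (auto simp: horizontal_edges_def)
  qed
  ultimately show ?thesis by (simp add: square_boundary_h_def shift2_def)
qed

lemma square_boundary_v_eq_0_outside:
  assumes "staircase q r Q" "supported (squares q r Q) s" "(a, c) \<notin> vertical_edges r Q"
  shows "square_boundary_v s a c = 0"
proof -
  have "s a c = 0" using assms(2,3) by (auto simp: supported_def squares_def vertical_edges_def)
  moreover have "s (a - 1) c = 0" if "a \<noteq> 0"
  proof (rule ccontr)
    assume "s (a - 1) c \<noteq> 0"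
    then have "(a - 1, c) \<in> Q" "a - 1 < q" "c < r"
      using assms(2) by (auto simp: supported_def squares_def)
    then show False
      using staircase_up[OF assms(1), of "a - 1" c a c] assms(3) by (auto simp: vertical_edges_def)
  qed
  ultimately show ?thesis by (simp add: square_boundary_v_def shift1_def)
qed

theorem staircase_resolution:
  fixes q r :: nat
  assumes Q: "staircase q r Q"
    and ps: "distinct ps" "set ps = Q" and es: "distinct es" "set es = edges q r Q"
    and ss: "distinct ss" "set ss = squares q r Q"
  obtains g :: "'k::field bipoly vec" and A where
    "minimal_bigraded_free_resolution {\<Sum>z\<in>Q. f z * vertex_monomial q r z | f. True}
      (\<lambda>u. if u = 0 then map (vertex_degree q r) ps else if u = 1 then map (edge_degree q r) es
        else if u = 2 then map (square_degree q r) ss else []) g A"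
proof -
  let ?M = "vertex_monomial q r :: nat \<times> nat \<Rightarrow> 'k bipoly"
  let ?d = "\<lambda>u::nat. if u = 0 then map (vertex_degree q r) ps else if u = 1 then map (edge_degree q r) es
        else if u = 2 then map (square_degree q r) ss else []"
  let ?fun = "\<lambda>xs F. vec (length xs) (\<lambda>j. F (xs ! j))"
  define g where "g = vec (length ps) (\<lambda>j. ?M (ps ! j))"
  define M1 :: "'k bipoly mat" where "M1 = mat (length ps) (length es) (\<lambda>(i, j). edge_coeff (ps ! i) (es ! j))"
  define M2 :: "'k bipoly mat" where "M2 = mat (length es) (length ss) (\<lambda>(i, j). square_coeff (es ! i) (ss ! j))"
  \<comment> \<open>Beyond the squares the source is the zero module, so the matrices have no
    columns. The one for \<open>u = 3\<close> has a row for each square, and exactness there is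
    injectivity of \<open>M2\<close>.\<close>
  define A where "A = (\<lambda>u. if u = 1 then M1 else if u = 2 then M2 else 0\<^sub>m (length (?d (u - 1))) 0)"
  have fin: "finite Q" "finite (edges q r Q)" "finite (squares q r Q)"
    by (metis List.finite_set ps(2), metis List.finite_set es(2), metis List.finite_set ss(2))
  have mem_edges: "(b, a, c) \<in> edges q r Q \<longleftrightarrow>
      (if b then (a, c) \<in> horizontal_edges q Q else (a, c) \<in> vertical_edges r Q)" for b a c
    by (cases b) (auto simp: edges_def)
  have supp_edges: "supported (horizontal_edges q Q) (\<lambda>a c. F (True, a, c)) \<and>
      supported (vertical_edges r Q) (\<lambda>a c. F (False, a, c)) \<longleftrightarrow> (\<forall>e. e \<notin> edges q r Q \<longrightarrow> F e = 0)"
    for F :: "bool \<times> nat \<times> nat \<Rightarrow> 'k bipoly"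
    by (simp only: supported_def split_paired_All all_bool_eq mem_edges if_True if_False)
  have g_fun: "g \<bullet> ?fun ps f = (\<Sum>z\<in>Q. f z * ?M z)" for f
    unfolding g_def scalar_prod_functions[OF ps(1)] ps(2) by (simp add: mult.commute)
  have M1_fun: "M1 *\<^sub>v ?fun es F =
      ?fun ps (\<lambda>(a, c). edge_boundary (\<lambda>a c. F (True, a, c)) (\<lambda>a c. F (False, a, c)) a c)"
    if "\<forall>e. e \<notin> edges q r Q \<longrightarrow> F e = 0" for F
  proof -
    have "(\<Sum>e\<in>edges q r Q. edge_coeff z e * F e) =
        (\<lambda>(a, c). edge_boundary (\<lambda>a c. F (True, a, c)) (\<lambda>a c. F (False, a, c)) a c) z" for z
      using sum_edge_coeff[OF fin(2) that] by (cases z) simp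
    then show ?thesis
      unfolding M1_def mat_vec_functions[OF es(1)] es(2) by (intro eq_vecI) simp_all
  qed
  have M2_fun: "M2 *\<^sub>v ?fun ss F =
      ?fun es (\<lambda>(b, a, c). if b then square_boundary_h (\<lambda>a c. F (a, c)) a c
        else square_boundary_v (\<lambda>a c. F (a, c)) a c)"
    if "\<forall>s. s \<notin> squares q r Q \<longrightarrow> F s = 0" for F
  proof -
    have "(\<Sum>s\<in>squares q r Q. square_coeff e s * F s) =
        (\<lambda>(b, a, c). if b then square_boundary_h (\<lambda>a c. F (a, c)) a c
          else square_boundary_v (\<lambda>a c. F (a, c)) a c) e" for e
      using sum_square_coeff[OF fin(3) that]
      by (cases e; cases "fst e") (simp_all only: fst_conv prod.case if_True if_False simp_thms)
    then show ?thesis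
      unfolding M2_def mat_vec_functions[OF ss(1)] ss(2) by (intro eq_vecI) simp_all
  qed
  have sum_split: "(\<Sum>z\<in>Q. f z * ?M z) = (\<Sum>(a, c)\<in>Q. f (a, c) * ?M (a, c))" for f
    by (intro sum.cong) auto
  have image: "{g \<bullet> v | v. v \<in> carrier_vec (length ps)} = {\<Sum>z\<in>Q. f z * ?M z | f. True}" (is "?L = ?R")
  proof (intro equalityI subsetI)
    fix y assume "y \<in> ?L"
    then obtain v where v: "v \<in> carrier_vec (length ps)" "y = g \<bullet> v" by blast
    from vec_as_function[OF ps(1) v(1)] obtain f where f: "v = ?fun ps f" by metis
    show "y \<in> ?R" unfolding v(2) f g_fun by blast
  next
    fix y assume "y \<in> ?R"
    then obtain f where "y = g \<bullet> ?fun ps f" unfolding g_fun by blast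
    then show "y \<in> ?L" by (intro CollectI exI[of _ "?fun ps f"] conjI vec_carrier)
  qed
  have ker0: "{v \<in> carrier_vec (length ps). g \<bullet> v = 0} = {M1 *\<^sub>v w | w. w \<in> carrier_vec (length es)}"
    (is "?L = ?R")
  proof (intro equalityI subsetI)
    fix v assume v: "v \<in> ?L"
    then have "v \<in> carrier_vec (length ps)" by blast
    from vec_as_function[OF ps(1) this] obtain f where f: "v = ?fun ps f" by metis
    have "g \<bullet> v = 0" using v by blast
    then have "(\<Sum>(a, c)\<in>Q. f (a, c) * ?M (a, c)) = 0" unfolding f g_fun sum_split .
    from exact_at_vertices[where f = "\<lambda>a c. f (a, c)", OF Q this] obtain h v'
      where hv: "supported (horizontal_edges q Q) h" "supported (vertical_edges r Q) v'"
        "\<forall>(a, c)\<in>Q. f (a, c) = edge_boundary h v' a c" by blast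
    define F where "F = (\<lambda>(b, a, c). if b then h a c else v' a c)"
    have F: "\<forall>e. e \<notin> edges q r Q \<longrightarrow> F e = 0"
      unfolding supp_edges[symmetric] using hv by (simp add: F_def)
    have "v = M1 *\<^sub>v ?fun es F"
      unfolding M1_fun[of F, OF F] f vec_functions_eq_iff using hv(3) by (auto simp: F_def ps(2))
    then show "v \<in> ?R" by (intro CollectI exI[of _ "?fun es F"] conjI vec_carrier)
  next
    fix v assume "v \<in> ?R"
    then obtain w where w: "w \<in> carrier_vec (length es)" "v = M1 *\<^sub>v w" by blast
    obtain F where F: "\<forall>e. e \<notin> edges q r Q \<longrightarrow> F e = 0" "w = ?fun es F"
      by (rule vec_as_function[OF es(1) w(1), unfolded es(2)])
    have v: "v = ?fun ps (\<lambda>(a, c). edge_boundary (\<lambda>a c. F (True, a, c)) (\<lambda>a c. F (False, a, c)) a c)"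
      unfolding w(2) F(2) by (rule M1_fun[of F, OF F(1)])
    have "g \<bullet> v = 0"
      unfolding v g_fun sum_split
      using sum_edge_boundary[OF Q, of "\<lambda>a c. F (True, a, c)" "\<lambda>a c. F (False, a, c)"]
        F(1)[folded supp_edges] unfolding prod.case by blast
    then show "v \<in> ?L" unfolding v by (intro CollectI conjI vec_carrier)
  qed
  have ker1: "{v \<in> carrier_vec (length es). M1 *\<^sub>v v = 0\<^sub>v (length ps)} =
      {M2 *\<^sub>v w | w. w \<in> carrier_vec (length ss)}" (is "?L = ?R")
  proof (intro equalityI subsetI)
    fix v assume v: "v \<in> ?L"
    then have v': "v \<in> carrier_vec (length es)" by blast
    obtain F where F: "\<forall>e. e \<notin> edges q r Q \<longrightarrow> F e = 0" "v = ?fun es F"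
      by (rule vec_as_function[OF es(1) v', unfolded es(2)])
    let ?h = "\<lambda>a c. F (True, a, c)" and ?v = "\<lambda>a c. F (False, a, c)"
    have "M1 *\<^sub>v ?fun es F = 0\<^sub>v (length ps)" using v F(2) by simp
    then have bd: "\<forall>(a, c)\<in>Q. edge_boundary ?h ?v a c = 0"
      unfolding M1_fun[of F, OF F(1)] vec_function_eq_0_iff ps(2) by auto
    have "supported (horizontal_edges q Q) ?h" "supported (vertical_edges r Q) ?v"
      using F(1)[folded supp_edges] by blast+
    from exact_at_edges[OF Q this bd] obtain s where
      s: "supported (squares q r Q) s" "\<And>a c. ?h a c = square_boundary_h s a c"
        "\<And>a c. ?v a c = square_boundary_v s a c" by blast
    have s0: "\<forall>z. z \<notin> squares q r Q \<longrightarrow> (\<lambda>(a, c). s a c) z = 0"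
      using s(1) by (simp add: supported_def)
    have "v = M2 *\<^sub>v ?fun ss (\<lambda>(a, c). s a c)"
      unfolding M2_fun[of "\<lambda>(a, c). s a c", OF s0] F(2) vec_functions_eq_iff
      using s(2,3) by auto
    then show "v \<in> ?R" by (intro CollectI exI[of _ "?fun ss (\<lambda>(a, c). s a c)"] conjI vec_carrier)
  next
    fix v assume "v \<in> ?R"
    then obtain w where w: "w \<in> carrier_vec (length ss)" "v = M2 *\<^sub>v w" by blast
    obtain s where s: "\<forall>z. z \<notin> squares q r Q \<longrightarrow> s z = 0" "w = ?fun ss s"
      by (rule vec_as_function[OF ss(1) w(1), unfolded ss(2)])
    let ?s = "\<lambda>a c. s (a, c)"
    let ?F = "\<lambda>(b, a, c). if b then square_boundary_h ?s a c else square_boundary_v ?s a c"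
    have v: "v = ?fun es ?F" unfolding w(2) s(2) by (rule M2_fun[of s, OF s(1)])
    \<comment> \<open>Cutting off outside the edges makes \<open>M1_fun\<close> applicable. The cut
      changes nothing, because the boundary of \<open>s\<close> vanishes there anyway.\<close>
    define F where "F = (\<lambda>e. if e \<in> edges q r Q then ?F e else 0)"
    have vF: "v = ?fun es F" unfolding v vec_functions_eq_iff by (simp add: F_def es(2))
    have F0: "\<forall>e. e \<notin> edges q r Q \<longrightarrow> F e = 0" by (simp add: F_def)
    have F_eq: "F = ?F"
    proof
      fix e :: "bool \<times> nat \<times> nat"
      obtain b a c where e: "e = (b, a, c)" by (metis surj_pair)
      have sup: "supported (squares q r Q) ?s" using s(1) by (simp add: supported_def)
      show "F e = ?F e"
      proof (cases b)
        case True
        then show ?thesis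
          using square_boundary_h_eq_0_outside[OF Q sup, of a c]
          by (auto simp: F_def e mem_edges)
      next
        case False
        then show ?thesis
          using square_boundary_v_eq_0_outside[OF Q sup, of a c]
          by (auto simp: F_def e mem_edges)
      qed
    qed
    have "edge_boundary (\<lambda>a c. F (True, a, c)) (\<lambda>a c. F (False, a, c)) a c = 0" for a c
      unfolding F_eq prod.case if_True if_False by (rule edge_boundary_square_boundary)
    then have "M1 *\<^sub>v v = 0\<^sub>v (length ps)"
      unfolding vF M1_fun[of F, OF F0] vec_function_eq_0_iff by auto
    then show "v \<in> ?L" unfolding vF by (intro CollectI conjI vec_carrier)
  qed
  have ker2: "v = 0\<^sub>v (length ss)"
    if v0: "v \<in> carrier_vec (length ss)" and M0: "M2 *\<^sub>v v = 0\<^sub>v (length es)" for v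
  proof -
    obtain s where s: "\<forall>z. z \<notin> squares q r Q \<longrightarrow> s z = 0" "v = ?fun ss s"
      by (rule vec_as_function[OF ss(1) v0, unfolded ss(2)])
    let ?s = "\<lambda>a c. s (a, c)"
    have sup: "supported (squares q r Q) ?s" using s(1) by (simp add: supported_def)
    have z: "\<forall>(b, a, c)\<in>edges q r Q. (if b then square_boundary_h ?s a c else square_boundary_v ?s a c) = 0"
      using M0 unfolding s(2) M2_fun[of s, OF s(1)] vec_function_eq_0_iff es(2)
      by auto
    have "square_boundary_h ?s a c = 0" for a c
    proof (cases "(a, c) \<in> horizontal_edges q Q")
      case True
      then have "(True, a, c) \<in> edges q r Q" by (simp add: mem_edges)
      then show ?thesis using z by auto
    qed (rule square_boundary_h_eq_0_outside[OF Q sup])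
    then have "s z = 0" for z
      using square_boundary_h_eq_0D[of ?s] by (cases z) blast
    then show ?thesis unfolding s(2) vec_function_eq_0_iff by blast
  qed
  have "minimal_bigraded_free_resolution {\<Sum>z\<in>Q. f z * ?M z | f. True} ?d g A"
    unfolding minimal_bigraded_free_resolution_def
  proof (intro conjI allI impI)
    show "g \<in> carrier_vec (length (?d 0))" by (simp add: g_def)
    show "A u \<in> carrier_mat (length (?d (u - 1))) (length (?d u))" if "1 \<le> u" for u
      using that by (auto simp: A_def M1_def M2_def)
    show "bihomogeneous (?d 0 ! s) (g $ s)" if "s < length (?d 0)" for s
    proof -
      obtain a c where "ps ! s = (a, c)" by fastforce
      moreover from this have "a \<le> q \<and> c \<le> r"
        using that staircase_bounds[OF Q, of a c] ps(2) nth_mem[of s ps] by simp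
      ultimately show ?thesis
        using that bihomogeneous_vertex_monomial[of a q c r] by (simp add: g_def)
    qed
    show "{g \<bullet> v | v. v \<in> carrier_vec (length (?d 0))} = {\<Sum>z\<in>Q. f z * ?M z | f. True}"
      using image by simp
    show "{v \<in> carrier_vec (length (?d 0)). g \<bullet> v = 0} = {A 1 *\<^sub>v w | w. w \<in> carrier_vec (length (?d 1))}"
      using ker0 by (simp add: A_def)
  next
    fix u :: nat assume "2 < u" then show "?d u = []" by simp
  next
    fix u :: nat assume u: "1 \<le> u"
    consider "u = 1" | "u = 2" | "2 < u" using u by linarith
    then show "{v \<in> carrier_vec (length (?d u)). A u *\<^sub>v v = 0\<^sub>v (length (?d (u - 1)))} =
      {A (u + 1) *\<^sub>v w | w. w \<in> carrier_vec (length (?d (u + 1)))}"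
    proof cases
      case 1
      then show ?thesis using ker1 by (simp add: A_def)
    next
      case 2
      have "{v \<in> carrier_vec (length ss). M2 *\<^sub>v v = 0\<^sub>v (length es)} = {0\<^sub>v (length ss)}"
        using ker2 by (auto simp: M2_def)
      then show ?thesis using 2 image_zero_columns[where 'a = "'k bipoly" and k = "length ss"] by (simp add: A_def)
    next
      case 3
      then have "A u = 0\<^sub>m (length (?d (u - 1))) 0" "A (u + 1) = 0\<^sub>m 0 0" "?d u = []" "?d (u + 1) = []"
        by (simp_all add: A_def)
      then show ?thesis
        by (simp only: list.size kernel_zero_columns image_zero_columns)
    qed
  next
    fix u s t assume *: "1 \<le> (u :: nat)" "s < length (?d (u - 1))" "t < length (?d u)"
    then have u: "u = 1 \<or> u = 2" by (auto split: if_splits)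
    then show "bihomogeneous (?d u ! t - ?d (u - 1) ! s) (A u $$ (s, t))"
      using * by (elim disjE) (simp_all add: A_def M1_def M2_def bihomogeneous_edge_coeff bihomogeneous_square_coeff)
    from u show "A u $$ (s, t) \<in> generated_ideal (range X)"
      using * by (elim disjE) (simp_all add: A_def M1_def M2_def coeffs_in_irrelevant_ideal)
  qed
  then show ?thesis by (rule that)
qed

section \<open>The region of the fat points\<close>

definition region :: "nat \<Rightarrow> nat \<Rightarrow> nat \<Rightarrow> (nat \<times> nat) set" where
  "region p q r = {(a, c). a \<le> q \<and> c \<le> r \<and> p \<le> a + c}"

lemma staircase_region: "staircase q r (region p q r)"
  by (auto simp: staircase_def region_def)

lemma region_combinations:
  assumes "p \<le> q" "p \<le> r"
  shows "{\<Sum>z\<in>region p q r. f z * vertex_monomial q r z | f. True} =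
    {g :: 'k::field bipoly. \<forall>m\<in>Poly_Mapping.keys g.
      p \<le> expo m 0 + expo m 2 \<and> q \<le> expo m 0 + expo m 3 \<and> r \<le> expo m 1 + expo m 2}"
    (is "?L = ?R")
proof (intro equalityI subsetI)
  fix g :: "'k bipoly" assume "g \<in> ?L"
  then obtain f where g: "g = (\<Sum>z\<in>region p q r. f z * vertex_monomial q r z)" by blast
  have "p \<le> expo m 0 + expo m 2 \<and> q \<le> expo m 0 + expo m 3 \<and> r \<le> expo m 1 + expo m 2"
    if m: "m \<in> Poly_Mapping.keys g" for m
  proof -
    obtain z where z: "z \<in> region p q r" "m \<in> Poly_Mapping.keys (f z * vertex_monomial q r z)"
      using m keys_sum[of "\<lambda>z. f z * vertex_monomial q r z" "region p q r"] unfolding g by blast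
    obtain a c where ac: "z = (a, c)" by fastforce
    obtain n where "m = vertex_exponent q r (a, c) + n"
      using z(2) unfolding ac vertex_monomial_def mult.commute[of "f (a, c)"] keys_single_times[OF one_neq_zero]
      by blast
    then have "expo m i = expo (vertex_exponent q r (a, c)) i + expo n i" for i
      by (simp add: lookup_add)
    then have "expo m 0 = a + expo n 0" "expo m 1 = r - c + expo n 1"
      "expo m 2 = c + expo n 2" "expo m 3 = q - a + expo n 3"
      by (simp_all only: lookup_vertex_exponent)
    moreover have "p \<le> a + c" "a \<le> q" "c \<le> r" using z(1) by (simp_all add: ac region_def)
    ultimately show ?thesis by linarith
  qed
  then show "g \<in> ?R" by blast
next
  fix g :: "'k bipoly" assume "g \<in> ?R"
  then have g: "p \<le> expo m 0 + expo m 2 \<and> q \<le> expo m 0 + expo m 3 \<and> r \<le> expo m 1 + expo m 2"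
    if "m \<in> Poly_Mapping.keys g" for m using that by blast
  have fin: "finite (region p q r)" by (rule staircase_finite[OF staircase_region])
  have "\<exists>f. g = (\<Sum>z\<in>region p q r. f z * vertex_monomial q r z)"
  proof (induction g rule: poly_mapping_monomial_induct)
    case (monomial m c)
    \<comment> \<open>Capping the exponents of x0 and x2 gives a vertex whose monomial divides
      \<open>m\<close>. If a cap is active, \<open>p \<le> q\<close> or \<open>p \<le> r\<close>
      keeps the vertex in the region; otherwise the condition on \<open>m\<close> itself
      does.\<close>
    let ?a = "min (expo m 0) q" and ?c = "min (expo m 2) r"
    let ?n = "m - vertex_exponent q r (?a, ?c)"
    have z: "(?a, ?c) \<in> region p q r"
      using g[OF monomial] assms by (auto simp: region_def min_def)
    have "m = vertex_exponent q r (?a, ?c) + ?n"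
      using g[OF monomial]
      by (intro exponents_eqI) (simp_all only: lookup_add lookup_minus lookup_vertex_exponent, linarith+)
    then have "Poly_Mapping.single m c = Poly_Mapping.single ?n c * vertex_monomial q r (?a, ?c)"
      by (metis add.commute mult.right_neutral mult_single vertex_monomial_def)
    also have "\<dots> = (\<Sum>z\<in>region p q r.
        (if z = (?a, ?c) then Poly_Mapping.single ?n c else 0) * vertex_monomial q r z)"
      using z fin by (simp add: if_distrib[of "\<lambda>y. y * _"] sum.delta cong: if_cong)
    finally show ?case
      by (rule exI[of _ "\<lambda>z. if z = (?a, ?c) then Poly_Mapping.single ?n c else 0"])
  next
    case (add g g')
    then obtain f f' where "g = (\<Sum>z\<in>region p q r. f z * vertex_monomial q r z)"
      "g' = (\<Sum>z\<in>region p q r. f' z * vertex_monomial q r z)" by blast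
    then have "g + g' = (\<Sum>z\<in>region p q r. (f z + f' z) * vertex_monomial q r z)"
      by (simp add: distrib_right sum.distrib)
    then show ?case by (rule exI[of _ "\<lambda>z. f z + f' z"])
  next
    show "\<exists>f. 0 = (\<Sum>z\<in>region p q r. f z * (vertex_monomial q r z :: 'k bipoly))"
      by (intro exI[of _ "\<lambda>_. 0"]) simp
  qed
  then show "g \<in> ?L" by blast
qed

section \<open>Counting cells by bidegree\<close>

lemma count_list_map_distinct:
  "distinct xs \<Longrightarrow> count_list (map f xs) y = card {x \<in> set xs. f x = y}"
  by (simp add: count_list_eq_length_filter filter_map distinct_length_filter comp_def Int_def
      conj_commute eq_commute)

text \<open>The smallest second coordinate of a vertex of the region on the diagonal \<open>a + r - c = A\<close>.\<close>

definition diagonal_start :: "nat \<Rightarrow> nat \<Rightarrow> int \<Rightarrow> int" where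
  "diagonal_start p r A = max (max 0 (int r - A)) ((int p + int r - A + 1) div 2)"

lemma diagonal_start_le_iff:
  "diagonal_start p r A \<le> x \<longleftrightarrow> 0 \<le> x \<and> int r - A \<le> x \<and> int p + int r - A \<le> 2 * x"
  unfolding diagonal_start_def by (auto; linarith)

text \<open>On a diagonal the second coordinate determines the first, so the points form an interval
  of values of \<open>c\<close>. The upper end \<open>h\<close> stays a parameter since vertices,
  edges and squares on a diagonal differ only in it.\<close>

lemma card_diagonal:
  "card {(a, c). int a + int r - int c = A \<and> p \<le> a + c \<and> int c \<le> h} =
    nat (h - diagonal_start p r A + 1)"
proof -
  have "{(a, c). int a + int r - int c = A \<and> p \<le> a + c \<and> int c \<le> h} =
      (\<lambda>c. (nat (A - int r + c), nat c)) ` {diagonal_start p r A..h}"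
  proof (intro equalityI subsetI)
    fix z :: "nat \<times> nat" assume "z \<in> {(a, c). int a + int r - int c = A \<and> p \<le> a + c \<and> int c \<le> h}"
    then obtain a c where z: "z = (a, c)" "int a + int r - int c = A" "p \<le> a + c" "int c \<le> h" by blast
    then have "diagonal_start p r A \<le> int c" unfolding diagonal_start_le_iff by linarith
    then show "z \<in> (\<lambda>c. (nat (A - int r + c), nat c)) ` {diagonal_start p r A..h}"
      using z by (intro image_eqI[of _ _ "int c"]) auto
  next
    fix z assume "z \<in> (\<lambda>c. (nat (A - int r + c), nat c)) ` {diagonal_start p r A..h}"
    then obtain c where c: "z = (nat (A - int r + c), nat c)" "diagonal_start p r A \<le> c" "c \<le> h" by auto
    then show "z \<in> {(a, c). int a + int r - int c = A \<and> p \<le> a + c \<and> int c \<le> h}"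
      unfolding diagonal_start_le_iff by auto
  qed
  moreover have "inj_on (\<lambda>c. (nat (A - int r + c), nat c)) {diagonal_start p r A..h}"
    using diagonal_start_le_iff[of p r A] by (auto simp: inj_on_def)
  ultimately show ?thesis by (simp add: card_image)
qed

text \<open>The second degree is \<open>B = c + q - a\<close>, so \<open>a \<le> q\<close> becomes
  \<open>c \<le> B\<close> on a diagonal, and the strict bound for horizontal edges becomes
  \<open>c \<le> B - 1\<close>.\<close>

lemma card_vertices:
  "card {z \<in> region p q r. vertex_degree q r z = (A, B)} =
    (if A + B = int q + int r then nat (min (int r) B - diagonal_start p r A + 1) else 0)"
proof (cases "A + B = int q + int r")
  case True
  then have "{z \<in> region p q r. vertex_degree q r z = (A, B)} =
      {(a, c). int a + int r - int c = A \<and> p \<le> a + c \<and> int c \<le> min (int r) B}"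
    by (auto simp: region_def)
  then show ?thesis by (simp only: card_diagonal True if_True simp_thms)
next
  case False
  then have "{z \<in> region p q r. vertex_degree q r z = (A, B)} = {}" by auto
  then show ?thesis by (simp only: False if_False card.empty)
qed

lemma card_horizontal_edges:
  "card {z \<in> horizontal_edges q (region p q r). vertex_degree q r z = (A, B)} =
    (if A + B = int q + int r then nat (min (int r) (B - 1) - diagonal_start p r A + 1) else 0)"
proof (cases "A + B = int q + int r")
  case True
  then have "{z \<in> horizontal_edges q (region p q r). vertex_degree q r z = (A, B)} =
      {(a, c). int a + int r - int c = A \<and> p \<le> a + c \<and> int c \<le> min (int r) (B - 1)}"
    by (auto simp: region_def horizontal_edges_def)
  then show ?thesis by (simp only: card_diagonal True if_True simp_thms)
next
  case False
  then have "{z \<in> horizontal_edges q (region p q r). vertex_degree q r z = (A, B)} = {}" by auto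
  then show ?thesis by (simp only: False if_False card.empty)
qed

lemma card_vertical_edges:
  "card {z \<in> vertical_edges r (region p q r). vertex_degree q r z = (A, B)} =
    (if A + B = int q + int r then nat (min (int r - 1) B - diagonal_start p r A + 1) else 0)"
proof (cases "A + B = int q + int r")
  case True
  then have "{z \<in> vertical_edges r (region p q r). vertex_degree q r z = (A, B)} =
      {(a, c). int a + int r - int c = A \<and> p \<le> a + c \<and> int c \<le> min (int r - 1) B}"
    by (auto simp: region_def vertical_edges_def)
  then show ?thesis by (simp only: card_diagonal True if_True simp_thms)
next
  case False
  then have "{z \<in> vertical_edges r (region p q r). vertex_degree q r z = (A, B)} = {}" by auto
  then show ?thesis by (simp only: False if_False card.empty)
qed

text \<open>The lower left vertex of a horizontal edge of degree \<open>(A, B)\<close> lies on the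
  diagonal of \<open>A - 1\<close>, that of a vertical one on the diagonal of \<open>A\<close>.
  Hence two different starting points occur.\<close>

lemma card_edges:
  "card {e \<in> edges q r (region p q r). edge_degree q r e = (A, B)} =
    (if A + B = int q + int r + 1 then
      nat (min (int r) (B - 1) - diagonal_start p r (A - 1) + 1) +
      nat (min (int r - 1) (B - 1) - diagonal_start p r A + 1) else 0)"
proof -
  let ?H = "{z \<in> horizontal_edges q (region p q r). vertex_degree q r z = (A - 1, B)}"
  let ?V = "{z \<in> vertical_edges r (region p q r). vertex_degree q r z = (A, B - 1)}"
  have fin: "finite ?H" "finite ?V"
    using staircase_finite[OF staircase_region[of q r p]]
    by (auto simp: horizontal_edges_def vertical_edges_def intro: finite_subset[rotated])
  have disj: "Pair True ` S \<inter> Pair False ` T = {}" for S T :: "(nat \<times> nat) set" by auto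
  have "x + (1, 0) = (A, B) \<longleftrightarrow> x = (A - 1, B)" "x + (0, 1) = (A, B) \<longleftrightarrow> x = (A, B - 1)" for x
    by (cases x; auto)+
  then have eq: "{e \<in> edges q r (region p q r). edge_degree q r e = (A, B)} = Pair True ` ?H \<union> Pair False ` ?V"
    by (auto simp: edges_def)
  have card_Pair: "card (Pair b ` S) = card S" for b :: bool and S :: "(nat \<times> nat) set"
    by (rule card_image) (rule inj_onI, simp only: prod.inject)
  have "card {e \<in> edges q r (region p q r). edge_degree q r e = (A, B)} = card ?H + card ?V"
    unfolding eq card_Un_disjoint[OF finite_imageI[OF fin(1)] finite_imageI[OF fin(2)] disj] card_Pair ..
  moreover have "A - 1 + B = int q + int r \<longleftrightarrow> A + B = int q + int r + 1"
    "A + (B - 1) = int q + int r \<longleftrightarrow> A + B = int q + int r + 1" by linarith+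
  ultimately show ?thesis
    unfolding card_horizontal_edges card_vertical_edges
    by (cases "A + B = int q + int r + 1") (simp_all only: if_True if_False add_0 simp_thms)
qed

lemma card_squares:
  "card {z \<in> squares q r (region p q r). square_degree q r z = (A, B)} =
    (if A + B = int q + int r + 2 then
      nat (min (int r - 1) (B - 2) - diagonal_start p r (A - 1) + 1) else 0)"
proof (cases "A + B = int q + int r + 2")
  case True
  then have "{z \<in> squares q r (region p q r). square_degree q r z = (A, B)} =
      {(a, c). int a + int r - int c = A - 1 \<and> p \<le> a + c \<and> int c \<le> min (int r - 1) (B - 2)}"
    by (auto simp: region_def squares_def square_degree_def)
  then show ?thesis by (simp only: card_diagonal True if_True simp_thms)
next
  case False
  then have "{z \<in> squares q r (region p q r). square_degree q r z = (A, B)} = {}"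
    by (auto simp: square_degree_def)
  then show ?thesis by (simp only: False if_False card.empty)
qed

text \<open>A diagonal leaves the rectangle through the side \<open>a = q\<close> or the side
  \<open>c = r\<close>. There \<open>p \<le> q\<close> or \<open>p \<le> r\<close> gives
  \<open>p \<le> a + c\<close>, so the diagonal meets the region.\<close>

lemma diagonal_start_le:
  assumes "p \<le> q" "p \<le> r" "0 \<le> A" "A \<le> int q + int r"
  shows "diagonal_start p r A \<le> min (int r) (int q + int r - A)"
  unfolding diagonal_start_le_iff using assms by (auto simp: min_def)

text \<open>Moving up by one step takes a point of the diagonal of \<open>A\<close> to that of
  \<open>A - 1\<close> and only increases \<open>a + c\<close>.\<close>

lemma diagonal_start_pred: "diagonal_start p r (A - 1) \<le> diagonal_start p r A + 1"
proof -
  have "0 \<le> diagonal_start p r A \<and> int r - A \<le> diagonal_start p r A \<and>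
      int p + int r - A \<le> 2 * diagonal_start p r A"
    using diagonal_start_le_iff[of p r A "diagonal_start p r A"] by simp
  then show ?thesis unfolding diagonal_start_le_iff by auto
qed

lemma diagonal_start_neg: "A < 0 \<Longrightarrow> int r < diagonal_start p r A"
  by (simp add: diagonal_start_def)

text \<open>The graph of \<open>phi t\<close> is a symmetric staircase with peak at
  \<open>t - 1\<close>. Passing from \<open>t - 1\<close> to \<open>t\<close> leaves the rising half
  and moves the falling half two places to the right, which adds 1 from the new peak on.\<close>

lemma phi_closed_form:
  "phi t n = (if 1 \<le> t \<and> 0 \<le> n \<and> n \<le> 2 * t - 2 then min n (2 * t - 2 - n) div 2 + 1 else 0)"
proof (induction "nat t" arbitrary: t)
  case 0
  then show ?case by (simp add: phi.simps)
next
  case (Suc k)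
  show ?case
  proof (cases "t = 1")
    case True
    then show ?thesis by (subst phi.simps) auto
  next
    case False
    then have t: "1 < t" and "k = nat (t - 1)" using Suc.hyps(2) by auto
    note IH = Suc.hyps(1)[OF this(2)]
    consider "n < 0" | "0 \<le> n" "n < t - 1" | "t - 1 \<le> n" "n \<le> 2 * t - 4"
      | "n = 2 * t - 3" | "n = 2 * t - 2" | "2 * t - 2 < n" by linarith
    then show ?thesis
    proof cases
      case 3
      then have "min n (2 * t - 2 - n) = 2 * t - 2 - n" "min n (2 * (t - 1) - 2 - n) = 2 * t - 4 - n"
        by (simp_all add: min_def)
      moreover have "(2 * t - 2 - n) div 2 = (2 * t - 4 - n) div 2 + 1" by presburger
      ultimately show ?thesis using 3 t by (subst phi.simps) (simp add: IH)
    qed (use t in \<open>subst phi.simps; auto simp: IH min_def\<close>)+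
  qed
qed

text \<open>On this diagonal the \<open>pos_part\<close> term counts the points with second
  coordinate at least \<open>p\<close>, where the condition \<open>p \<le> a + c\<close> on the
  coordinates is automatic, and the \<open>phi2\<close> term counts those with second coordinate
  below \<open>p\<close>.\<close>

lemma vertex_count_formula:
  fixes p q r a b :: nat
  assumes "p \<le> r" "r \<le> q" "a + b = r + q"
  shows "int (nat (min (int r) (int b) - diagonal_start p r (int a) + 1)) =
    pos_part (Min {int a, int b - int p, int r - int p} + 1) + phi2 (int q) (int q - int p) (int b)"
proof -
  \<comment> \<open>The coordinates of a point on this diagonal add up to
    \<open>2 * c + q - b\<close>, so \<open>- v\<close> is the least \<open>c\<close> for which the
    sum reaches \<open>p\<close>, rounding included.\<close>
  define v where "v = (int q - int p - int b) div 2"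
  have a: "int a = int q + int r - int b" using assms(3) by linarith
  have v: "2 * v \<le> int q - int p - int b" "int q - int p - int b \<le> 2 * v + 1"
    unfolding v_def by presburger+
  have start: "diagonal_start p r (int a) = max (max 0 (int b - int q)) (- v)"
    unfolding diagonal_start_def a v_def by (rule arg_cong2[of _ _ _ _ max]; presburger?; simp)
  have phi_d: "phi (int q - int p) (int b + (int q - int p)) = max v 0"
  proof (cases "int b \<le> int q - int p - 2")
    case True
    then have "min (int b + (int q - int p)) (2 * (int q - int p) - 2 - (int b + (int q - int p))) =
        int q - int p - int b - 2" by (simp add: min_def)
    moreover have "(int q - int p - int b - 2) div 2 + 1 = v" unfolding v_def by presburger
    moreover have "1 \<le> v" using True v by linarith
    ultimately show ?thesis using True unfolding phi_closed_form by simp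
  next
    case False
    then show ?thesis using v unfolding phi_closed_form by simp
  qed
  \<comment> \<open>The argument lies on the rising half of \<open>phi q\<close> exactly if
    \<open>b < p\<close>. For \<open>phi (q - p)\<close> it is always past the peak, so no such
    distinction arose.\<close>
  have phi_q: "phi (int q) (int b + (int q - int p)) = (if b < p then int b + v + 1 else max (v + int p) 0)"
  proof (cases "b < p")
    case True
    then have "min (int b + (int q - int p)) (2 * int q - 2 - (int b + (int q - int p))) = int b + (int q - int p)"
      using assms(1,2) by (intro min_absorb1) linarith
    moreover have "(int b + (int q - int p)) div 2 = int b + v" unfolding v_def by presburger
    ultimately show ?thesis using True assms(1,2) unfolding phi_closed_form by simp
  next
    case bp: False
    show ?thesis
    proof (cases "int b + (int q - int p) \<le> 2 * int q - 2")
      case True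
      then have "min (int b + (int q - int p)) (2 * int q - 2 - (int b + (int q - int p))) =
          int q - int b + int p - 2"
        using bp by (simp add: min_def)
      moreover have "(int q - int b + int p - 2) div 2 + 1 = v + int p" unfolding v_def by presburger
      moreover have "0 \<le> v + int p" using True v by linarith
      ultimately show ?thesis using bp True assms(1,2) unfolding phi_closed_form by simp
    next
      case False
      then show ?thesis using bp v unfolding phi_closed_form by simp
    qed
  qed
  have "Min {int a, int b - int p, int r - int p} = min (int a) (min (int b - int p) (int r - int p))"
    by simp
  then have "pos_part (Min {int a, int b - int p, int r - int p} + 1) +
      phi2 (int q) (int q - int p) (int b) =
      max (min (int a) (min (int b - int p) (int r - int p)) + 1) 0 +
      ((if b < p then int b + v + 1 else max (v + int p) 0) - max v 0)"
    by (simp only: pos_part_def phi2_def phi_d phi_q)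
  also have "\<dots> = min (int r) (int b) - diagonal_start p r (int a) + 1"
  proof (cases "b < p")
    case True
    then show ?thesis unfolding start using v a assms(1,2) by simp
  next
    case False
    then show ?thesis unfolding start using v a assms(1,2) by simp
  qed
  also have "\<dots> = int (nat (min (int r) (int b) - diagonal_start p r (int a) + 1))"
    using diagonal_start_le[of p q r "int a"] assms a by simp
  finally show ?thesis by (rule sym)
qed

section \<open>Betti numbers of the fat point ideal\<close>

lemma region_resolution:
  fixes p q r :: nat
  assumes "p \<le> q" "p \<le> r"
  obtains d g A where
    "minimal_bigraded_free_resolution (fat_points_ideal (X 0) (X 1) (X 2) (X 3 :: 'k::field bipoly) p q r) d g A"
    "\<And>e. count_list (d 0) e = card {z \<in> region p q r. vertex_degree q r z = e}"
    "\<And>e. count_list (d 1) e = card {x \<in> edges q r (region p q r). edge_degree q r x = e}"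
    "\<And>e. count_list (d 2) e = card {z \<in> squares q r (region p q r). square_degree q r z = e}"
proof -
  note Q = staircase_region[of q r p]
  note fin = staircase_finite[OF Q]
  have "finite (horizontal_edges q (region p q r))" "finite (vertical_edges r (region p q r))"
    by (rule finite_subset[OF _ fin], auto simp: horizontal_edges_def vertical_edges_def)+
  then have finE: "finite (edges q r (region p q r))" by (simp add: edges_def)
  have finS: "finite (squares q r (region p q r))"
    by (rule finite_subset[OF _ fin]) (auto simp: squares_def)
  obtain ps where ps: "distinct ps" "set ps = region p q r"
    using finite_distinct_list[OF fin] by metis
  obtain es where es: "distinct es" "set es = edges q r (region p q r)"
    using finite_distinct_list[OF finE] by metis
  obtain ss where ss: "distinct ss" "set ss = squares q r (region p q r)"
    using finite_distinct_list[OF finS] by metis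
  let ?d = "\<lambda>u::nat. if u = 0 then map (vertex_degree q r) ps else if u = 1 then map (edge_degree q r) es
        else if u = 2 then map (square_degree q r) ss else []"
  obtain g :: "'k bipoly vec" and A where res: "minimal_bigraded_free_resolution
      {\<Sum>z\<in>region p q r. f z * vertex_monomial q r z | f. True} ?d g A"
    by (rule staircase_resolution[OF Q ps es ss])
  have ideal: "fat_points_ideal (X 0) (X 1) (X 2) (X 3 :: 'k bipoly) p q r =
      {\<Sum>z\<in>region p q r. f z * vertex_monomial q r z | f. True}"
    unfolding fat_points_ideal_coordinates region_combinations[OF assms] ..
  show ?thesis
  proof (rule that)
    show "minimal_bigraded_free_resolution (fat_points_ideal (X 0) (X 1) (X 2) (X 3 :: 'k bipoly) p q r) ?d g A"
      unfolding ideal by (rule res)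
    show "count_list (?d 0) e = card {z \<in> region p q r. vertex_degree q r z = e}" for e
      using count_list_map_distinct[OF ps(1), of "vertex_degree q r" e] unfolding ps(2) by simp
    show "count_list (?d 1) e = card {x \<in> edges q r (region p q r). edge_degree q r x = e}" for e
      using count_list_map_distinct[OF es(1), of "edge_degree q r" e] unfolding es(2) by simp
    show "count_list (?d 2) e = card {z \<in> squares q r (region p q r). square_degree q r z = e}" for e
      using count_list_map_distinct[OF ss(1), of "square_degree q r" e] unfolding ss(2) by simp
  qed
qed

text \<open>Every edge of degree \<open>(A, B)\<close> joins a vertex of degree
  \<open>(A - 1, B)\<close> to one of degree \<open>(A, B - 1)\<close>. Horizontal and vertical
  edges alternate, so the points of the two diagonals form one zigzag path, which has one edge less
  than vertices.\<close>

lemma edge_count_formula: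
  fixes p q r :: nat and A B :: int
  assumes "p \<le> q" "p \<le> r" "0 \<le> A" "0 \<le> B" "A + B = int q + int r + 1"
  shows "int (nat (min (int r) (B - 1) - diagonal_start p r (A - 1) + 1) +
      nat (min (int r - 1) (B - 1) - diagonal_start p r A + 1)) =
    pos_part (int (nat (min (int r) (B - 1) - diagonal_start p r A + 1)) +
      int (nat (min (int r) B - diagonal_start p r (A - 1) + 1)) - 1)"
proof -
  let ?l = "diagonal_start p r A" and ?l' = "diagonal_start p r (A - 1)"
  have B: "B = int q + int r + 1 - A" using assms(5) by linarith
  \<comment> \<open>In the first two cases one diagonal misses the rectangle and the other consists
    of a corner: \<open>(0, r)\<close> for \<open>A = 0\<close> and \<open>(q, 0)\<close> for
    \<open>B = 0\<close>. The path is a single point without edges.\<close>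
  consider "A = 0" | "B = 0" | "1 \<le> A" "1 \<le> B" using assms(3,4) by linarith
  then show ?thesis
  proof cases
    case 1
    have "?l = int r" using assms(2) by (simp add: 1 diagonal_start_def)
    moreover have "int r < ?l'" using 1 by (intro diagonal_start_neg) simp
    ultimately show ?thesis using 1 B by (simp add: pos_part_def min_def)
  next
    case 2
    have "0 \<le> ?l" "0 \<le> ?l'" by (simp_all add: diagonal_start_def)
    moreover have "?l' \<le> 0"
      unfolding diagonal_start_le_iff using assms(1) 2 B by auto
    ultimately show ?thesis using 2 by (auto simp: pos_part_def min_def)
  next
    case 3
    have "?l \<le> int r \<and> ?l \<le> B - 1" using diagonal_start_le[of p q r A] assms 3 B by simp
    moreover have "?l' \<le> int r \<and> ?l' \<le> B" using diagonal_start_le[of p q r "A - 1"] assms 3 B by simp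
    moreover have "?l' \<le> ?l + 1" by (rule diagonal_start_pred)
    ultimately show ?thesis by (auto simp: pos_part_def min_def)
  qed
qed

text \<open>The lower left and upper right corners of a square are neighbours on the same diagonal,
  so squares are the gaps between consecutive points; \<open>pos_part\<close> covers the empty
  diagonal.\<close>

lemma square_count_formula:
  "int (nat (min (int r - 1) (B - 2) - l + 1)) =
    pos_part (int (nat (min (int r) (B - 1) - l + 1)) - 1)"
  by (simp add: pos_part_def min_def)

theorem theorem4p1:
  fixes H1 H2 V1 V2 :: "'k::field_char_0 bipoly"
    and m11 m12 m21 :: nat
  assumes "bihomogeneous (1, 0) H1" "bihomogeneous (1, 0) H2"
    and "H1 \<noteq> 0" "H2 \<noteq> 0" "\<nexists>c. H1 = scalar c * H2"
    and "bihomogeneous (0, 1) V1" "bihomogeneous (0, 1) V2"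
    and "V1 \<noteq> 0" "V2 \<noteq> 0" "\<nexists>c. V1 = scalar c * V2"
    and "m12 \<ge> m21" and "m11 \<le> m21"
  shows "let \<beta> = bigraded_betti (fat_points_ideal H1 H2 V1 V2 m11 m12 m21) in
    \<forall>a b :: nat.
      int (\<beta> 0 (int a, int b)) =
        (if a + b = m21 + m12
         then pos_part (Min {int a, int b - int m11, int m21 - int m11} + 1) +
              phi2 (int m12) (int m12 - int m11) (int b)
         else 0) \<and>
      int (\<beta> 1 (int a, int b)) =
        pos_part (int (\<beta> 0 (int a, int b - 1)) + int (\<beta> 0 (int a - 1, int b)) - 1) \<and>
      int (\<beta> 2 (int a, int b)) =
        pos_part (int (\<beta> 0 (int a - 1, int b - 1)) - 1)"
proof -
  have le: "m11 \<le> m12" "m11 \<le> m21" using assms(11,12) by simp_all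
  define \<beta> where "\<beta> = bigraded_betti (fat_points_ideal H1 H2 V1 V2 m11 m12 m21)"
  obtain \<sigma> \<tau> where aut: "bigraded_automorphism \<sigma> \<tau>"
    and \<sigma>: "\<sigma> (X 0) = H1" "\<sigma> (X 1) = H2" "\<sigma> (X 2) = V1" "\<sigma> (X 3) = V2"
    by (rule coordinate_change[OF assms(1,2,4,5,6,7,9,10)])
  obtain d and g :: "'k bipoly vec" and A where
    res: "minimal_bigraded_free_resolution (fat_points_ideal (X 0) (X 1) (X 2) (X 3) m11 m12 m21) d g A"
    and d: "\<And>e. count_list (d 0) e = card {z \<in> region m11 m12 m21. vertex_degree m12 m21 z = e}"
    "\<And>e. count_list (d 1) e = card {x \<in> edges m12 m21 (region m11 m12 m21). edge_degree m12 m21 x = e}"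
    "\<And>e. count_list (d 2) e = card {z \<in> squares m12 m21 (region m11 m12 m21). square_degree m12 m21 z = e}"
    by (rule region_resolution[OF le]) blast
  from bigraded_automorphism.minimal_resolution_image[OF aut res]
  have "minimal_bigraded_free_resolution (fat_points_ideal H1 H2 V1 V2 m11 m12 m21) d
      (map_vec \<sigma> g) (\<lambda>u. map_mat \<sigma> (A u))"
    unfolding bigraded_automorphism.image_fat_points_ideal[OF aut] \<sigma> .
  from bigraded_betti_eq[OF this] have \<beta>: "\<beta> u e = count_list (d u) e" for u e
    by (simp only: \<beta>_def)
  let ?l = "diagonal_start m11 m21"
  \<comment> \<open>The degrees are arbitrary integers here, so the shifted degrees with entry -1
    are included. There the start of the diagonal exceeds the upper bound and the count is
    0.\<close>
  have \<beta>0: "\<beta> 0 (A, B) = (if A + B = int m12 + int m21 then nat (min (int m21) B - ?l A + 1) else 0)" for A B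
    unfolding \<beta> d card_vertices ..
  have \<beta>1: "\<beta> 1 (A, B) = (if A + B = int m12 + int m21 + 1 then
      nat (min (int m21) (B - 1) - ?l (A - 1) + 1) + nat (min (int m21 - 1) (B - 1) - ?l A + 1) else 0)" for A B
    unfolding \<beta> d card_edges ..
  have \<beta>2: "\<beta> 2 (A, B) = (if A + B = int m12 + int m21 + 2 then
      nat (min (int m21 - 1) (B - 2) - ?l (A - 1) + 1) else 0)" for A B
    unfolding \<beta> d card_squares ..
  have "int (\<beta> 0 (int a, int b)) =
        (if a + b = m21 + m12
         then pos_part (Min {int a, int b - int m11, int m21 - int m11} + 1) +
              phi2 (int m12) (int m12 - int m11) (int b)
         else 0)" for a b :: nat
  proof (cases "a + b = m21 + m12")
    case True
    then have "int a + int b = int m12 + int m21" by linarith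
    then show ?thesis
      unfolding \<beta>0 using vertex_count_formula[OF assms(12,11) True] True by (simp only: if_True simp_thms)
  next
    case False
    then have "int a + int b \<noteq> int m12 + int m21" by linarith
    then show ?thesis unfolding \<beta>0 using False by simp
  qed
  moreover have "int (\<beta> 1 (int a, int b)) =
        pos_part (int (\<beta> 0 (int a, int b - 1)) + int (\<beta> 0 (int a - 1, int b)) - 1)" for a b :: nat
  proof (cases "int a + int b = int m12 + int m21 + 1")
    case True
    then have "int a + (int b - 1) = int m12 + int m21" "int a - 1 + int b = int m12 + int m21" by linarith+
    then show ?thesis
      unfolding \<beta>0 \<beta>1 using edge_count_formula[OF le _ _ True] True by (simp only: if_True simp_thms of_nat_0_le_iff)
  next
    case False
    then have "int a + (int b - 1) \<noteq> int m12 + int m21" "int a - 1 + int b \<noteq> int m12 + int m21" by linarith+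
    then show ?thesis unfolding \<beta>0 \<beta>1 using False by (simp add: pos_part_def)
  qed
  moreover have "int (\<beta> 2 (int a, int b)) = pos_part (int (\<beta> 0 (int a - 1, int b - 1)) - 1)" for a b :: nat
  proof (cases "int a + int b = int m12 + int m21 + 2")
    case True
    then have "int a - 1 + (int b - 1) = int m12 + int m21" by linarith
    then show ?thesis
      unfolding \<beta>0 \<beta>2 using square_count_formula[of m21 "int b" "?l (int a - 1)"] True
      by (simp only: if_True simp_thms)
  next
    case False
    then have "int a - 1 + (int b - 1) \<noteq> int m12 + int m21" by linarith
    then show ?thesis unfolding \<beta>0 \<beta>2 using False by (simp add: pos_part_def)
  qed
  ultimately show ?thesis unfolding Let_def \<beta>_def[symmetric] by blast
qed

end
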